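(* Let $n$ be the maximum number of keys, let the key universe $\mathcal{U}$ satisfy $|\mathcal{U}| = \mathrm{poly}(n)$, and let $v \ge 1$ be the value length in bits. There is an incremental retrieval data structure that supports all of its operations (queries, updates, insertions) using an expected size of at most $$ nv + O(n) + O\!\left( \max\left\{ n \log\!\left( \frac{\log n}{v} \right),\, 0\right\} \right) $$ bits.
   Context: A retrieval data structure stores a set $K \subseteq \mathcal{U}$ of at most $n$ keys, each $k\in K$ associated with a $v$-bit value $f(k)$, and answers $\mathrm{Query}(k)$ with $f(k)$ if $k\in K$ and with an arbitrary output if $k\notin K$ (it need not be able to tell whether $k \in K$). An incremental retrieval data structure supports queries, $\mathrm{Update}(k,f)$ (for $k\in K$, change the stored value of $k$ to $f$), and $\mathrm{Insert}(k,f)$ (for $k\notin K$ with $|K|<n$, add $k$ to $K$ with value $f$); deletions are not supported. The size is the number of bits of memory used; the data structure may be randomized and the size is measured in expectation. Logarithms are base 2. *)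

theory Defs
  imports "HOL-Probability.Probability"
begin

type_synonym bits = "bool list"

text \<open>
  The memory of a data structure is a bit string, and it is all that persists between operations:
  random choices to be reused later (hash seeds, say) have to be kept in it and are charged for.
  Operations may toss fresh coins, hence the distributions. The parameters \<open>n\<close>, \<open>v\<close> and the
  universe are known to the data structure and are not stored. Running times are not modelled.
\<close>

record 'k retrieval_ds =
  ds_init :: "bits pmf"
  ds_insert :: "'k \<Rightarrow> bits \<Rightarrow> bits \<Rightarrow> bits pmf"
  ds_update :: "'k \<Rightarrow> bits \<Rightarrow> bits \<Rightarrow> bits pmf"
  ds_query :: "'k \<Rightarrow> bits \<Rightarrow> bits"

datatype 'k operation = Insert 'k bits | Update 'k bits

text \<open>The abstract state is the partial map \<open>f\<close> with domain \<open>K\<close>.\<close>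

fun legal_op :: "nat \<Rightarrow> nat \<Rightarrow> 'k set \<Rightarrow> ('k \<rightharpoonup> bits) \<Rightarrow> 'k operation \<Rightarrow> bool" where
  "legal_op n v U M (Insert k x) \<longleftrightarrow>
     k \<in> U \<and> k \<notin> dom M \<and> card (dom M) < n \<and> length x = v"
| "legal_op n v U M (Update k x) \<longleftrightarrow> k \<in> dom M \<and> length x = v"

fun apply_op :: "('k \<rightharpoonup> bits) \<Rightarrow> 'k operation \<Rightarrow> ('k \<rightharpoonup> bits)" where
  "apply_op M (Insert k x) = M(k \<mapsto> x)"
| "apply_op M (Update k x) = M(k \<mapsto> x)"

fun legal_from :: "nat \<Rightarrow> nat \<Rightarrow> 'k set \<Rightarrow> ('k \<rightharpoonup> bits) \<Rightarrow> 'k operation list \<Rightarrow> bool" where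
  "legal_from n v U M [] \<longleftrightarrow> True"
| "legal_from n v U M (a # as) \<longleftrightarrow> legal_op n v U M a \<and> legal_from n v U (apply_op M a) as"

definition legal :: "nat \<Rightarrow> nat \<Rightarrow> 'k set \<Rightarrow> 'k operation list \<Rightarrow> bool" where
  "legal n v U as \<longleftrightarrow> legal_from n v U Map.empty as"

definition contents :: "'k operation list \<Rightarrow> ('k \<rightharpoonup> bits)" where
  "contents as = foldl apply_op Map.empty as"

fun exec_op :: "'k retrieval_ds \<Rightarrow> 'k operation \<Rightarrow> bits \<Rightarrow> bits pmf" where
  "exec_op D (Insert k x) s = ds_insert D k x s"
| "exec_op D (Update k x) s = ds_update D k x s"

text \<open>The distribution of the memory after a sequence of operations fixed in advance.\<close>

definition memory_after :: "'k retrieval_ds \<Rightarrow> 'k operation list \<Rightarrow> bits pmf" where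
  "memory_after D as = foldl (\<lambda>p a. bind_pmf p (exec_op D a)) (ds_init D) as"

text \<open>Queries on stored keys never err; nothing is required of \<open>ds_query\<close> on other keys.\<close>

definition incremental_retrieval :: "nat \<Rightarrow> nat \<Rightarrow> 'k set \<Rightarrow> 'k retrieval_ds \<Rightarrow> bool" where
  "incremental_retrieval n v U D \<longleftrightarrow>
     (\<forall>as. legal n v U as \<longrightarrow>
        (\<forall>s \<in> set_pmf (memory_after D as). \<forall>k x.
           contents as k = Some x \<longrightarrow> ds_query D k s = x))"

text \<open>A nonnegative integral, so that an infinite expectation is not collapsed to 0.\<close>

definition expected_size :: "'k retrieval_ds \<Rightarrow> 'k operation list \<Rightarrow> ennreal" where
  "expected_size D as = (\<integral>\<^sup>+ s. of_nat (length s) \<partial>measure_pmf (memory_after D as))"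

definition expected_size_at_most :: "nat \<Rightarrow> nat \<Rightarrow> 'k set \<Rightarrow> 'k retrieval_ds \<Rightarrow> real \<Rightarrow> bool" where
  "expected_size_at_most n v U D B \<longleftrightarrow>
     (\<forall>as. legal n v U as \<longrightarrow> expected_size D as \<le> ennreal B)"

end

theory Submission
  imports Defs "HOL-Library.AList" "HOL-Library.Sublist"
begin

text \<open>
  Hash every key to a long bit string by a random linear map over GF(2); its matrix has
  \<open>O(log\<^sup>2 n)\<close> entries and is kept in memory. Store the values in the leaves of the binary trie of
  the hashes. A leaf does not record whose value it holds: a new key whose path runs into a leaf is
  listed explicitly as an exception, at a cost of \<open>O(log n)\<close> bits.

  If \<open>i\<close> keys are present, a branch that belongs to a single key is cut off at depth
  \<open>D i = log n + log (log n / v) + (n - i) v / (3 n)\<close>, where a \<open>v\<close> exceeding the key length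
  \<open>O(log n)\<close> is replaced by the latter. Below the top \<open>log n\<close> levels the trie then
  spends about \<open>3 (D i - log n)\<close> bits per key, and the part that depends on \<open>i\<close> fits into the
  \<open>(n - i) v\<close> bits reserved for values yet to come. Keys that agree on more than \<open>D i\<close> hash bits
  keep longer branches, but this adds only \<open>O(n)\<close> inner nodes in expectation.
  A new key becomes an exception only if it agrees with an earlier key on the first \<open>D i\<close> hash bits,
  which has probability at most \<open>n / 2 ^ D i\<close>. These probabilities form a geometric series in \<open>i\<close>
  whose sum is \<open>O(n / log n)\<close>, so that all exceptions together cost \<open>O(n)\<close> bits.
\<close>

section \<open>Bit strings\<close>

lemma finite_bits_length: "finite {u :: bits. length u = n}"
  using finite_lists_length_eq[of "UNIV :: bool set" n] by simp

lemma card_bits_length: "card {u :: bits. length u = n} = 2 ^ n"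
  using card_lists_length_eq[of "UNIV :: bool set" n] by simp

lemma finite_bits_shorter: "finite {u :: bits. length u < n}"
  by (rule finite_subset[OF _ finite_lists_length_le[of "UNIV :: bool set" n]]) auto

lemma card_bits_shorter_le: "card {u :: bits. length u < n} \<le> 2 ^ n"
proof -
  have "{u :: bits. length u < n} = (\<Union>j<n. {u. length u = j})" by auto
  then have "card {u :: bits. length u < n} \<le> (\<Sum>j<n. card {u :: bits. length u = j})"
    using card_UN_le[of "{..<n}"] by simp
  also have "\<dots> \<le> 2 ^ n" by (simp add: card_bits_length lessThan_atLeast0 sum_power2)
  finally show ?thesis .
qed

lemma card_bits_Suc:
  "card {u :: bits. length u = Suc n \<and> P u} =
    card {u. length u = n \<and> P (False # u)} + card {u. length u = n \<and> P (True # u)}"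
proof -
  have "{u :: bits. length u = Suc n \<and> P u} =
      (#) False ` {u. length u = n \<and> P (False # u)} \<union> (#) True ` {u. length u = n \<and> P (True # u)}"
    (is "?L = ?R")
  proof (rule set_eqI)
    show "u \<in> ?L \<longleftrightarrow> u \<in> ?R" for u by (cases u; cases "hd u") (auto simp: image_iff)
  qed
  moreover have "finite {u :: bits. length u = n \<and> Q u}" for Q
    by (rule finite_subset[OF _ finite_bits_length[of n]]) auto
  ultimately show ?thesis by (simp, subst card_Un_disjoint) (auto simp: card_image)
qed

lemma ex_fixed_length_code:
  assumes "finite U" "card U \<le> 2 ^ \<kappa>"
  shows "\<exists>f. inj_on f U \<and> (\<forall>k\<in>U. length (f k :: bits) = \<kappa>)"
proof -
  obtain f where "inj_on f U" "f ` U \<subseteq> {u :: bits. length u = \<kappa>}"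
    using card_le_inj[of U "{u :: bits. length u = \<kappa>}"] assms
    by (auto simp: finite_bits_length card_bits_length)
  then show ?thesis by blast
qed

section \<open>Tries with cut-off branches\<close>

datatype 'v trie = Empty | Leaf 'v | Node "'v trie" "'v trie"

fun trie_lookup :: "'v trie \<Rightarrow> bits \<Rightarrow> 'v option" where
  "trie_lookup Empty xs = None"
| "trie_lookup (Leaf x) xs = Some x"
| "trie_lookup (Node l r) [] = None"
| "trie_lookup (Node l r) (b # xs) = trie_lookup (if b then r else l) xs"

fun branch :: "bits \<Rightarrow> 'v \<Rightarrow> 'v trie" where
  "branch [] x = Leaf x"
| "branch (b # xs) x = (if b then Node Empty (branch xs x) else Node (branch xs x) Empty)"

fun trie_update :: "nat \<Rightarrow> bits \<Rightarrow> 'v \<Rightarrow> 'v trie \<Rightarrow> 'v trie" where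
  "trie_update d xs y Empty = branch (take d xs) y"
| "trie_update d xs y (Leaf x) = Leaf y"
| "trie_update d [] y (Node l r) = Node l r"
| "trie_update d (b # xs) y (Node l r) =
     (if b then Node l (trie_update (d - 1) xs y r) else Node (trie_update (d - 1) xs y l) r)"

fun trie_values :: "'v trie \<Rightarrow> 'v list" where
  "trie_values Empty = []"
| "trie_values (Leaf x) = [x]"
| "trie_values (Node l r) = trie_values l @ trie_values r"

fun prune :: "nat \<Rightarrow> 'v trie \<Rightarrow> 'v trie" where
  "prune d Empty = Empty"
| "prune d (Leaf x) = Leaf x"
| "prune d (Node l r) =
     (if d = 0 \<and> length (trie_values (Node l r)) = 1 then Leaf (hd (trie_values (Node l r)))
      else Node (prune (d - 1) l) (prune (d - 1) r))"

fun inner_nodes :: "'v trie \<Rightarrow> bits set" where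
  "inner_nodes Empty = {}"
| "inner_nodes (Leaf x) = {}"
| "inner_nodes (Node l r) = insert [] ((#) False ` inner_nodes l \<union> (#) True ` inner_nodes r)"

definition below :: "bool \<Rightarrow> (bits \<rightharpoonup> 'v) \<Rightarrow> bits \<rightharpoonup> 'v" where
  "below b M = (\<lambda>xs. M (b # xs))"

text \<open>
  \<open>d\<close> is the distance from the root to the cut-off depth. From there on, every inner node has two
  strings below it and is thus paid for by a collision.
\<close>

fun represents :: "nat \<Rightarrow> 'v trie \<Rightarrow> (bits \<rightharpoonup> 'v) \<Rightarrow> bool" where
  "represents d Empty M \<longleftrightarrow> M = Map.empty"
| "represents d (Leaf x) M \<longleftrightarrow> d = 0 \<and> (\<exists>xs. M = [xs \<mapsto> x])"
| "represents d (Node l r) M \<longleftrightarrow> M [] = None \<and> (if d = 0 then 2 else 1) \<le> card (dom M) \<and>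
     represents (d - 1) l (below False M) \<and> represents (d - 1) r (below True M)"

lemma dom_below: "dom (below b M) = {xs. b # xs \<in> dom M}"
  by (auto simp: below_def)

lemma below_empty: "below b Map.empty = Map.empty"
  by (simp add: below_def)

lemma below_upd:
  "below c (M(b # xs \<mapsto> y)) = (if b = c then (below c M)(xs \<mapsto> y) else below c M)"
  by (auto simp: below_def)

lemma dom_eq_Cons_image_Un:
  assumes "M [] = None"
  shows "dom M = (#) False ` dom (below False M) \<union> (#) True ` dom (below True M)"
proof (rule set_eqI)
  show "xs \<in> dom M \<longleftrightarrow> xs \<in> (#) False ` dom (below False M) \<union> (#) True ` dom (below True M)" for xs
    using assms by (cases xs; cases "hd xs") (auto simp: image_iff below_def)
qed

lemma represents_Leaf: "represents 0 (Leaf x) [xs \<mapsto> x]"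
  unfolding represents.simps by blast

lemma represents_finite: "represents d T M \<Longrightarrow> finite (dom M)"
proof (induction T arbitrary: d M)
  case (Node l r)
  then have "finite (dom (below False M))" "finite (dom (below True M))" "M [] = None" by auto
  then show ?case by (simp only: dom_eq_Cons_image_Un finite_Un finite_imageI)
qed auto

lemma represents_trie_values:
  "represents d T M \<Longrightarrow> length (trie_values T) = card (dom M) \<and> set (trie_values T) = ran M"
proof (induction T arbitrary: d M)
  case (Node l r)
  let ?Ml = "below False M" and ?Mr = "below True M"
  have rep: "represents (d - 1) l ?Ml" "represents (d - 1) r ?Mr" using Node.prems by auto
  have dom: "dom M = (#) False ` dom ?Ml \<union> (#) True ` dom ?Mr"
    using Node.prems by (intro dom_eq_Cons_image_Un) simp
  have "card (dom M) = card (dom ?Ml) + card (dom ?Mr)"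
    using rep[THEN represents_finite]
    by (subst dom, subst card_Un_disjoint) (auto simp: card_image)
  moreover have "ran M = ran ?Ml \<union> ran ?Mr"
  proof -
    have "ran N = (the \<circ> N) ` dom N" for N :: "bits \<rightharpoonup> 'a" by (force simp: ran_def image_iff)
    from this[of M] this[of ?Ml] this[of ?Mr] show ?thesis
      unfolding dom by (simp add: image_Un image_image below_def)
  qed
  ultimately show ?case using Node.IH(1)[OF rep(1)] Node.IH(2)[OF rep(2)] by simp
qed auto

lemma represents_trie_lookup: "represents d T M \<Longrightarrow> M xs = Some x \<Longrightarrow> trie_lookup T xs = Some x"
proof (induction T xs arbitrary: d M rule: trie_lookup.induct)
  case (4 l r b xs)
  then have "below b M xs = Some x" by (simp add: below_def)
  then show ?case using 4 by (cases b) auto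
qed (auto split: if_splits)

lemma represents_trie_lookup_prefix:
  "represents d T M \<Longrightarrow> trie_lookup T xs = Some x \<Longrightarrow> \<exists>ys\<in>dom M. take d ys = take d xs"
proof (induction T xs arbitrary: d M rule: trie_lookup.induct)
  case (4 l r b xs)
  then have "represents (d - 1) (if b then r else l) (below b M)" by (cases b) auto
  then obtain ys where "b # ys \<in> dom M" "take (d - 1) ys = take (d - 1) xs"
    using 4 by (fastforce simp: below_def)
  then show ?case by (cases d) force+
qed auto

lemma represents_branch: "d \<le> length xs \<Longrightarrow> represents d (branch (take d xs) y) [xs \<mapsto> y]"
proof (induction d arbitrary: xs)
  case (Suc d)
  then obtain b zs where "xs = b # zs" "d \<le> length zs" by (cases xs) auto
  then show ?case using Suc.IH[of zs]
    by (cases b) (simp_all add: below_upd below_empty fun_upd_other del: fun_upd_apply)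
qed auto

lemma represents_trie_update:
  assumes "represents d T M" "trie_lookup T xs = None \<or> xs \<in> dom M"
    and "d \<le> length xs" "dom M \<subseteq> {ys. length ys = length xs}"
  shows "represents d (trie_update d xs y T) (M(xs \<mapsto> y))"
  using assms
proof (induction d xs y T arbitrary: M rule: trie_update.induct)
  case (1 d xs y)
  then show ?case using represents_branch[of d xs y] by (simp del: fun_upd_apply)
next
  case (2 d xs y x)
  then have "d = 0" "M(xs \<mapsto> y) = [xs \<mapsto> y]" by (auto split: if_splits)
  then show ?case using represents_Leaf[of y xs] by (simp only: trie_update.simps)
next
  case (3 d y l r)
  then have "dom M \<subseteq> {[]}" "[] \<notin> dom M" by auto
  then have "dom M = {}" by blast
  then show ?case using "3.prems"(1) by (simp split: if_splits)
next
  case (4 d b xs y l r)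
  have "trie_lookup (if b then r else l) xs = None \<or> xs \<in> dom (below b M)" "d - 1 \<le> length xs"
    "dom (below b M) \<subseteq> {ys. length ys = length xs}"
    using "4.prems"(2-4) by (auto simp: dom_below)
  then have "represents (d - 1) (trie_update (d - 1) xs y (if b then r else l))
      ((below b M)(xs \<mapsto> y))"
    using "4.IH" "4.prems"(1) by (cases b) (simp_all del: fun_upd_apply)
  moreover have "card (dom M) \<le> card (insert (b # xs) (dom M))"
    using represents_finite[OF "4.prems"(1)] by (intro card_mono) auto
  ultimately show ?case using "4.prems"(1)
    by (cases b) (simp_all add: below_upd fun_upd_other del: fun_upd_apply split: if_splits)
qed

lemma represents_prune: "represents d' T M \<Longrightarrow> d \<le> d' \<Longrightarrow> represents d (prune d T) M"
proof (induction T arbitrary: d d' M)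
  case (Node l r)
  let ?vs = "trie_values (Node l r)"
  have values_eq: "length ?vs = card (dom M)" "set ?vs = ran M"
    using represents_trie_values[OF Node.prems(1)] by auto
  show ?case
  proof (cases "d = 0 \<and> length ?vs = 1")
    case True
    then obtain xs x where singleton: "M = [xs \<mapsto> x]"
      using values_eq(1) by (metis card_1_singletonE dom_eq_singleton_conv)
    have "?vs \<noteq> []" using True by auto
    then have "hd ?vs \<in> set ?vs" by (rule hd_in_set)
    moreover have "set ?vs = {x}" using values_eq(2) singleton by simp
    ultimately have "hd ?vs = x" by blast
    then have "prune d (Node l r) = Leaf x" using True by (simp only: prune.simps simp_thms if_True)
    then show ?thesis using True singleton represents_Leaf[of x xs] by (simp only:)
  next
    case False
    then have "(if d = 0 then 2 else 1) \<le> card (dom M)"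
      using Node.prems values_eq(1) by (auto split: if_splits)
    moreover have "represents (d - 1) (prune (d - 1) l) (below False M)"
      "represents (d - 1) (prune (d - 1) r) (below True M)"
      using Node.prems by (auto intro!: Node.IH[of "d' - 1"])
    moreover have "prune d (Node l r) = Node (prune (d - 1) l) (prune (d - 1) r)"
      using False by (simp only: prune.simps if_False)
    ultimately show ?thesis using Node.prems(1) by simp
  qed
qed auto

lemma finite_inner_nodes: "finite (inner_nodes T)"
  by (induction T) auto

lemma card_inner_nodes_Node:
  "card (inner_nodes (Node l r)) = Suc (card (inner_nodes l) + card (inner_nodes r))"
proof -
  have "card ((#) False ` inner_nodes l \<union> (#) True ` inner_nodes r) =
      card (inner_nodes l) + card (inner_nodes r)"
    by (subst card_Un_disjoint) (auto simp: finite_inner_nodes card_image)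
  moreover have "[] \<notin> (#) False ` inner_nodes l \<union> (#) True ` inner_nodes r" by auto
  ultimately show ?thesis by (simp add: finite_inner_nodes)
qed

lemma card_extensions_inner_node_ge:
  "represents d T M \<Longrightarrow> p \<in> inner_nodes T \<Longrightarrow>
    (if length p < d then 1 else 2) \<le> card {xs \<in> dom M. prefix p xs}"
proof (induction T arbitrary: d M p)
  case (Node l r)
  show ?case
  proof (cases p)
    case Nil
    then show ?thesis using Node.prems(1) by auto
  next
    case (Cons b p')
    have "{xs \<in> dom M. prefix p xs} = (#) b ` {xs \<in> dom (below b M). prefix p' xs}"
      unfolding Cons by (auto simp: below_def prefix_def)
    then have "card {xs \<in> dom M. prefix p xs} = card {xs \<in> dom (below b M). prefix p' xs}"
      by (simp add: card_image)
    moreover have "(if length p' < d - 1 then 1 else 2) \<le> card {xs \<in> dom (below b M). prefix p' xs}"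
      using Node.prems Node.IH[of "d - 1" "below b M" p'] Cons by (cases b) auto
    moreover have "length p < d \<longleftrightarrow> length p' < d - 1" unfolding Cons by auto
    ultimately show ?thesis by presburger
  qed
qed auto

definition collisions :: "('k \<Rightarrow> bits) \<Rightarrow> nat \<Rightarrow> 'k set \<Rightarrow> ('k \<times> 'k \<times> nat) set" where
  "collisions h d K = {(k, k', j). k \<in> K \<and> k' \<in> K \<and> k \<noteq> k' \<and> j \<in> {d..<length (h k)} \<and>
     take j (h k) = take j (h k')}"

lemma finite_collisions:
  assumes "finite K"
  shows "finite (collisions h d K)"
proof (rule finite_subset)
  show "collisions h d K \<subseteq> (SIGMA k:K. K \<times> {..<length (h k)})" by (auto simp: collisions_def)
qed (use assms in auto)

lemma inner_node_collision:
  assumes "represents d T M" "p \<in> inner_nodes T" "d \<le> length p" "dom M \<subseteq> h ` K"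
  shows "\<exists>(k, k', j) \<in> collisions h d K. p = take j (h k)"
proof -
  let ?X = "{xs \<in> dom M. prefix p xs}"
  have "2 \<le> card ?X" using card_extensions_inner_node_ge[OF assms(1,2)] assms(3) by simp
  then have not_singleton: "\<not> ?X \<subseteq> {xs}" for xs using card_mono[of "{xs}" ?X] by auto
  then obtain xs where ext_xs: "xs \<in> dom M" "prefix p xs" "xs \<noteq> p" by blast
  obtain ys where ext_ys: "ys \<in> dom M" "prefix p ys" "ys \<noteq> xs"
    using not_singleton[of xs] by blast
  obtain k k' where keys: "k \<in> K" "xs = h k" "k' \<in> K" "ys = h k'"
    using assms(4) ext_xs(1) ext_ys(1) by blast
  have prefixes: "p = take (length p) xs" "p = take (length p) ys" "length p < length xs"
    using ext_xs ext_ys by (auto simp: prefix_def)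
  then have "(k, k', length p) \<in> collisions h d K"
    using keys ext_ys(3) assms(3) by (auto simp: collisions_def)
  then show ?thesis using prefixes(1) keys(2) by blast
qed

lemma card_inner_nodes_le:
  assumes rep: "represents d T M" and "finite K" and hashes: "dom M \<subseteq> h ` K"
  shows "card (inner_nodes T) \<le> 2 ^ l + card (dom M) * (d - l) + card (collisions h d K)"
proof -
  let ?top = "{p :: bits. length p < l}"
    and ?middle = "(\<lambda>(xs, j). take j xs) ` (dom M \<times> {l..<d})"
    and ?bottom = "(\<lambda>(k, k', j). take j (h k)) ` collisions h d K"
  have fin: "finite (dom M)" by (rule represents_finite[OF rep])
  have "inner_nodes T \<subseteq> ?top \<union> ?middle \<union> ?bottom"
  proof
    fix p assume inner: "p \<in> inner_nodes T"
    consider "length p < l" | "length p \<in> {l..<d}" | "d \<le> length p" by force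
    then show "p \<in> ?top \<union> ?middle \<union> ?bottom"
    proof cases
      case 2
      then have "{xs \<in> dom M. prefix p xs} \<noteq> {}"
        using card_extensions_inner_node_ge[OF rep inner] by (auto simp del: Collect_empty_eq)
      then obtain xs where "xs \<in> dom M" "prefix p xs" by blast
      then have "p = take (length p) xs" "(xs, length p) \<in> dom M \<times> {l..<d}"
        using 2 by (auto simp: prefix_def)
      then show ?thesis by (force simp: image_iff)
    next
      case 3
      then show ?thesis using inner_node_collision[OF rep inner _ hashes] by force
    qed simp
  qed
  then have "card (inner_nodes T) \<le> card (?top \<union> ?middle \<union> ?bottom)"
    using fin \<open>finite K\<close> by (intro card_mono) (auto simp: finite_bits_shorter finite_collisions)
  also have "\<dots> \<le> card ?top + card ?middle + card ?bottom"
    by (intro order_trans[OF card_Un_le] add_right_mono card_Un_le)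
  also have "\<dots> \<le> 2 ^ l + card (dom M \<times> {l..<d}) + card (collisions h d K)"
    using fin \<open>finite K\<close>
    by (intro add_mono card_bits_shorter_le card_image_le finite_collisions) auto
  finally show ?thesis by (simp add: card_cartesian_product)
qed

section \<open>Prefix codes\<close>

definition prefix_code :: "('a \<Rightarrow> bits) \<Rightarrow> 'a set \<Rightarrow> bool" where
  "prefix_code f A \<longleftrightarrow> (\<forall>a\<in>A. \<forall>b\<in>A. \<forall>xs ys. f a @ xs = f b @ ys \<longrightarrow> a = b)"

lemma prefix_codeI:
  assumes "\<And>a b xs ys. a \<in> A \<Longrightarrow> b \<in> A \<Longrightarrow> f a @ xs = f b @ ys \<Longrightarrow> a = b"
  shows "prefix_code f A"
  unfolding prefix_code_def using assms by blast

lemma prefix_codeD: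
  assumes "prefix_code f A" "a \<in> A" "b \<in> A" "f a @ xs = f b @ ys"
  shows "a = b" "xs = ys"
proof -
  show "a = b" using assms unfolding prefix_code_def by blast
  with assms(4) show "xs = ys" by simp
qed

lemma prefix_code_inj_on: "prefix_code f A \<Longrightarrow> inj_on f A"
  by (rule inj_onI) (auto dest: prefix_codeD(1)[where xs = "[]" and ys = "[]"])

lemma prefix_code_fixed_length:
  assumes "inj_on f A" "\<And>a. a \<in> A \<Longrightarrow> length (f a) = n"
  shows "prefix_code f A"
  using assms by (intro prefix_codeI) (auto simp: inj_on_def)

definition pair_code :: "('a \<Rightarrow> bits) \<Rightarrow> ('b \<Rightarrow> bits) \<Rightarrow> 'a \<times> 'b \<Rightarrow> bits" where
  "pair_code f g = (\<lambda>(a, b). f a @ g b)"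

lemma prefix_code_pair_code:
  assumes "prefix_code f A" "prefix_code g B"
  shows "prefix_code (pair_code f g) (A \<times> B)"
proof (rule prefix_codeI)
  fix p q xs ys
  assume "p \<in> A \<times> B" "q \<in> A \<times> B" and codes_eq: "pair_code f g p @ xs = pair_code f g q @ ys"
  then obtain a b a' b' where p_eq: "p = (a, b)" "a \<in> A" "b \<in> B"
    and q_eq: "q = (a', b')" "a' \<in> A" "b' \<in> B"
    by blast
  have "f a @ (g b @ xs) = f a' @ (g b' @ ys)"
    using codes_eq p_eq(1) q_eq(1) by (simp add: pair_code_def)
  note fst_eq = prefix_codeD[OF assms(1) p_eq(2) q_eq(2) this]
  note snd_eq = prefix_codeD(1)[OF assms(2) p_eq(3) q_eq(3) fst_eq(2)]
  show "p = q" using fst_eq(1) snd_eq p_eq(1) q_eq(1) by simp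
qed

fun list_code :: "('a \<Rightarrow> bits) \<Rightarrow> 'a list \<Rightarrow> bits" where
  "list_code f [] = [False]"
| "list_code f (x # xs) = True # f x @ list_code f xs"

lemma prefix_code_list_code:
  assumes "prefix_code f A"
  shows "prefix_code (list_code f) (lists A)"
proof (rule prefix_codeI)
  show "as = bs" if "as \<in> lists A" "bs \<in> lists A" "list_code f as @ xs = list_code f bs @ ys"
    for as bs xs ys
    using that
  proof (induction as arbitrary: bs rule: list.induct)
    case Nil
    then show ?case by (cases bs) auto
  next
    case (Cons a as)
    then obtain b bs' where bs_eq: "bs = b # bs'" by (cases bs) auto
    have "f a @ (list_code f as @ xs) = f b @ (list_code f bs' @ ys)"
      using Cons.prems(3) bs_eq by simp
    note head_eq = prefix_codeD[OF assms _ _ this]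
    show ?case using head_eq Cons bs_eq by auto
  qed
qed

lemma length_list_code:
  "(\<And>x. x \<in> set xs \<Longrightarrow> length (f x) = n) \<Longrightarrow> length (list_code f xs) = 1 + length xs * (1 + n)"
  by (induction xs) auto

fun trie_code :: "('v \<Rightarrow> bits) \<Rightarrow> 'v trie \<Rightarrow> bits" where
  "trie_code f Empty = [False, False]"
| "trie_code f (Leaf x) = [False, True] @ f x"
| "trie_code f (Node l r) = True # trie_code f l @ trie_code f r"

lemma prefix_code_trie_code:
  assumes "prefix_code f A"
  shows "prefix_code (trie_code f) {T. set (trie_values T) \<subseteq> A}"
proof (rule prefix_codeI)
  show "T = T'" if "T \<in> {T. set (trie_values T) \<subseteq> A}" "T' \<in> {T. set (trie_values T) \<subseteq> A}"
    "trie_code f T @ xs = trie_code f T' @ ys" for T T' xs ys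
    using that
  proof (induction T arbitrary: T' xs ys)
    case Empty
    then show ?case by (cases T') auto
  next
    case (Leaf x)
    then show ?case using prefix_codeD(1)[OF assms] by (cases T') auto
  next
    case (Node l r)
    obtain l' r' where node_eq: "T' = Node l' r'" using Node.prems(3) by (cases T') auto
    have codes_eq: "trie_code f l @ (trie_code f r @ xs) = trie_code f l' @ (trie_code f r' @ ys)"
      using Node.prems(3) node_eq by simp
    have "l = l'" using Node.prems node_eq by (intro Node.IH(1)[OF _ _ codes_eq]) auto
    moreover from this codes_eq have "r = r'" using Node.prems node_eq by (intro Node.IH(2)) auto
    ultimately show ?case using node_eq by simp
  qed
qed

lemma length_trie_code:
  "(\<And>x. x \<in> set (trie_values T) \<Longrightarrow> length (f x) = n) \<Longrightarrow>
    length (trie_code f T) = 3 * card (inner_nodes T) + 2 + length (trie_values T) * n"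
proof (induction T)
  case (Node l r)
  then show ?case unfolding card_inner_nodes_Node by (simp add: algebra_simps)
qed auto

section \<open>Hashing by random matrices over GF(2)\<close>

fun dot :: "bits \<Rightarrow> bits \<Rightarrow> bool" where
  "dot (a # u) (b # x) = ((a \<and> b) \<noteq> dot u x)"
| "dot u x = False"

lemma card_dot_eq:
  assumes "length x = length y" "x \<noteq> y"
  shows "2 * card {u. length u = length x \<and> dot u x = dot u y} = 2 ^ length x"
  using assms
proof (induction x y rule: list_induct2)
  case (Cons b x b' y)
  let ?n = "length x"
  let ?Eq = "{u. length u = ?n \<and> dot u x = dot u y}"
    and ?Ne = "{u. length u = ?n \<and> dot u x \<noteq> dot u y}"
  show ?case
  proof (cases "b = b'")
    case True
    have "(p \<noteq> q) = (p \<noteq> r) \<longleftrightarrow> q = r" for p q r :: bool by auto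
    with True Cons show ?thesis by (simp add: card_bits_Suc)
  next
    case False
    then have "card {u. length u = Suc ?n \<and> dot u (b # x) = dot u (b' # y)} = card ?Eq + card ?Ne"
      by (auto simp: card_bits_Suc intro!: arg_cong[where f = card])
    also have "\<dots> = card (?Eq \<union> ?Ne)"
      by (rule card_Un_disjoint[symmetric])
        (auto intro: finite_subset[OF _ finite_bits_length[of ?n]])
    also have "?Eq \<union> ?Ne = {u :: bits. length u = ?n}" by auto
    finally show ?thesis by (simp add: card_bits_length)
  qed
qed simp

definition bit_matrices :: "nat \<Rightarrow> nat \<Rightarrow> bits list set" where
  "bit_matrices m n = {s. set s \<subseteq> {u. length u = n} \<and> length s = m}"

definition mat_vec :: "bits list \<Rightarrow> bits \<Rightarrow> bits" where
  "mat_vec s x = map (\<lambda>u. dot u x) s"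

lemma finite_bit_matrices: "finite (bit_matrices m n)"
  unfolding bit_matrices_def by (rule finite_lists_length_eq[OF finite_bits_length])

lemma bit_matrices_0: "bit_matrices 0 n = {[]}"
  by (auto simp: bit_matrices_def)

lemma bit_matrices_Suc:
  "bit_matrices (Suc m) n = case_prod (#) ` ({u. length u = n} \<times> bit_matrices m n)"
  by (auto simp: bit_matrices_def length_Suc_conv image_iff)

lemma card_bit_matrices_Suc: "card (bit_matrices (Suc m) n) = 2 ^ n * card (bit_matrices m n)"
  unfolding bit_matrices_Suc
  by (subst card_image) (auto simp: inj_on_def card_cartesian_product card_bits_length)

lemma bit_matrices_nonempty: "bit_matrices m n \<noteq> {}"
  using Ex_list_of_length by (induction m) (auto simp: bit_matrices_0 bit_matrices_Suc)

lemma length_concat_bit_matrix: "s \<in> bit_matrices m n \<Longrightarrow> length (concat s) = m * n"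
  by (induction m arbitrary: s) (auto simp: bit_matrices_0 bit_matrices_Suc)

lemma inj_on_concat_bit_matrices: "inj_on concat (bit_matrices m n)"
proof (rule inj_onI)
  fix s t assume matrices: "s \<in> bit_matrices m n" "t \<in> bit_matrices m n" "concat s = concat t"
  then have "\<forall>(u, w) \<in> set (zip s t). length u = length w"
    unfolding bit_matrices_def by (auto dest: set_zip_leftD set_zip_rightD)
  with matrices show "s = t" by (intro concat_injective) (auto simp: bit_matrices_def)
qed

lemma card_mat_vec_eq:
  assumes "length x = n" "length y = n" "x \<noteq> y"
  shows "j \<le> m \<Longrightarrow>
    2 ^ j * card {s \<in> bit_matrices m n. take j (mat_vec s x) = take j (mat_vec s y)} =
      card (bit_matrices m n)"
proof (induction j arbitrary: m)
  case (Suc j)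
  then obtain m' where m_eq: "m = Suc m'" "j \<le> m'" by (cases m) auto
  let ?rows = "{u. length u = n \<and> dot u x = dot u y}"
    and ?agree = "\<lambda>j m. {s \<in> bit_matrices m n. take j (mat_vec s x) = take j (mat_vec s y)}"
  have "?agree (Suc j) m = case_prod (#) ` (?rows \<times> ?agree j m')"
    unfolding m_eq(1) bit_matrices_Suc by (auto simp: mat_vec_def image_iff)
  then have "card (?agree (Suc j) m) = card ?rows * card (?agree j m')"
    by (simp add: card_image inj_on_def card_cartesian_product)
  then have "2 ^ Suc j * card (?agree (Suc j) m) = (2 * card ?rows) * (2 ^ j * card (?agree j m'))"
    by simp
  also have "\<dots> = 2 ^ n * card (bit_matrices m' n)"
    using card_dot_eq[of x y] assms Suc.IH[OF m_eq(2)] by simp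
  also have "\<dots> = card (bit_matrices m n)" unfolding m_eq(1) card_bit_matrices_Suc ..
  finally show ?case .
qed simp

definition universal_hash :: "'k set \<Rightarrow> nat \<Rightarrow> 's pmf \<Rightarrow> ('s \<Rightarrow> 'k \<Rightarrow> bits) \<Rightarrow> bool" where
  "universal_hash U m S h \<longleftrightarrow> finite (set_pmf S) \<and> (\<forall>s\<in>set_pmf S. \<forall>k\<in>U. length (h s k) = m) \<and>
     (\<forall>k\<in>U. \<forall>k'\<in>U. \<forall>j\<le>m. k \<noteq> k' \<longrightarrow>
        measure_pmf.prob S {s. take j (h s k) = take j (h s k')} \<le> 1 / 2 ^ j)"

lemma universal_hash_mat_vec:
  assumes inj: "inj_on f U" and len: "\<And>k. k \<in> U \<Longrightarrow> length (f k) = n"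
  shows "universal_hash U m (pmf_of_set (bit_matrices m n)) (\<lambda>s k. mat_vec s (f k))"
  unfolding universal_hash_def
proof (intro conjI ballI allI impI)
  let ?B = "bit_matrices m n"
  note set_B = set_pmf_of_set[OF bit_matrices_nonempty finite_bit_matrices, of m n]
  show "finite (set_pmf (pmf_of_set ?B))" by (simp add: set_B finite_bit_matrices)
  show "length (mat_vec s (f k)) = m" if "s \<in> set_pmf (pmf_of_set ?B)" for s k
    using that unfolding set_B by (auto simp: mat_vec_def bit_matrices_def)
  fix k k' j assume keys: "k \<in> U" "k' \<in> U" "k \<noteq> k'" and "j \<le> m"
  let ?P = "\<lambda>s. take j (mat_vec s (f k)) = take j (mat_vec s (f k'))"
  have pos: "0 < card ?B"
    using bit_matrices_nonempty finite_bit_matrices by (simp add: card_gt_0_iff)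
  have "2 ^ j * card {s \<in> ?B. ?P s} = card ?B"
    using keys \<open>j \<le> m\<close> len inj by (intro card_mat_vec_eq) (auto dest: inj_onD)
  then have "real (2 ^ j * card {s \<in> ?B. ?P s}) = real (card ?B)" by (simp only:)
  then have "real (card {s \<in> ?B. ?P s}) / real (card ?B) = 1 / 2 ^ j"
    using pos by (simp add: field_simps)
  moreover have "?B \<inter> {s. ?P s} = {s \<in> ?B. ?P s}" by blast
  ultimately show "measure_pmf.prob (pmf_of_set ?B) {s. ?P s} \<le> 1 / 2 ^ j"
    by (simp only: measure_pmf_of_set[OF bit_matrices_nonempty finite_bit_matrices] order_refl)
qed

lemma prob_prefix_collision_le:
  assumes hash: "universal_hash U m S h" and "finite K" "K \<subseteq> U" "k \<in> U" "k \<notin> K" "j \<le> m"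
  shows "measure_pmf.prob S {s. \<exists>k'\<in>K. take j (h s k') = take j (h s k)} \<le> real (card K) / 2 ^ j"
proof -
  have "{s. \<exists>k'\<in>K. take j (h s k') = take j (h s k)} =
      (\<Union>k'\<in>K. {s. take j (h s k') = take j (h s k)})"
    by auto
  then have "measure_pmf.prob S {s. \<exists>k'\<in>K. take j (h s k') = take j (h s k)} \<le>
      (\<Sum>k'\<in>K. measure_pmf.prob S {s. take j (h s k') = take j (h s k)})"
    using measure_pmf.finite_measure_subadditive_finite[OF \<open>finite K\<close>] by (simp only:) auto
  also have "\<dots> \<le> (\<Sum>k'\<in>K. 1 / 2 ^ j)"
    using assms unfolding universal_hash_def by (intro sum_mono) (metis subsetD)
  finally show ?thesis by simp
qed

lemma sum_half_powers_le: "(\<Sum>j = d..<m. 1 / 2 ^ j) \<le> 2 / (2::real) ^ d"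
proof -
  have "(\<Sum>j = d..<d + e. 1 / 2 ^ j) = 2 / 2 ^ d - 2 / (2::real) ^ (d + e)" for e
  proof (induction e)
    case (Suc e)
    have "2 / (2::real) ^ (d + e) = 2 / 2 ^ (d + Suc e) + 1 / 2 ^ (d + e)" by simp
    then show ?case using Suc by simp
  qed simp
  from this[of "m - d"] show ?thesis by (cases "d \<le> m") auto
qed

lemma expectation_card_filter:
  assumes "finite A"
  shows "measure_pmf.expectation S (\<lambda>s. real (card {a \<in> A. P s a})) =
    (\<Sum>a\<in>A. measure_pmf.prob S {s. P s a})"
proof -
  have "measure_pmf.expectation S (\<lambda>s. real (card {a \<in> A. P s a})) =
      measure_pmf.expectation S (\<lambda>s. \<Sum>a\<in>A. indicator {s. P s a} s)"
    using assms by (simp add: indicator_def Collect_conj_eq)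
  also have "\<dots> = (\<Sum>a\<in>A. measure_pmf.expectation S (indicator {s. P s a}))"
    by (intro Bochner_Integration.integral_sum measure_pmf.integrable_const_bound[where B = 1])
      (auto simp: indicator_def)
  finally show ?thesis by simp
qed

lemma expectation_collisions_le:
  assumes hash: "universal_hash U m S h" and "finite K" "K \<subseteq> U"
  shows "measure_pmf.expectation S (\<lambda>s. real (card (collisions (h s) d K))) \<le>
    2 * (real (card K))\<^sup>2 / 2 ^ d"
proof -
  define A where "A = {(k, k', j). k \<in> K \<and> k' \<in> K \<and> k \<noteq> k' \<and> j \<in> {d..<m}}"
  define agree where "agree s = (\<lambda>(k, k', j). take j (h s k) = take j (h s k'))" for s
  have A_subset: "A \<subseteq> K \<times> K \<times> {d..<m}" by (auto simp: A_def)
  then have "finite A" by (rule finite_subset) (use \<open>finite K\<close> in auto)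
  have "collisions (h s) d K = {p \<in> A. agree s p}" if "s \<in> set_pmf S" for s
    using that hash \<open>K \<subseteq> U\<close> unfolding universal_hash_def collisions_def A_def agree_def
    by (auto simp: subset_iff)
  then have "measure_pmf.expectation S (\<lambda>s. real (card (collisions (h s) d K))) =
      measure_pmf.expectation S (\<lambda>s. real (card {p \<in> A. agree s p}))"
    by (intro integral_cong_AE) (auto simp: AE_measure_pmf_iff)
  also have "\<dots> = (\<Sum>p\<in>A. measure_pmf.prob S {s. agree s p})"
    using \<open>finite A\<close> by (rule expectation_card_filter)
  also have "\<dots> \<le> (\<Sum>(k, k', j)\<in>A. 1 / 2 ^ j)"
    using hash \<open>K \<subseteq> U\<close> unfolding universal_hash_def A_def agree_def
    by (intro sum_mono) (auto simp: subset_iff)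
  also have "\<dots> \<le> (\<Sum>(k, k', j)\<in>K \<times> K \<times> {d..<m}. 1 / 2 ^ j)"
    using \<open>finite K\<close> by (intro sum_mono2 A_subset) auto
  also have "\<dots> = (real (card K))\<^sup>2 * (\<Sum>j = d..<m. 1 / 2 ^ j)"
    by (simp add: power2_eq_square flip: sum.cartesian_product)
  also have "\<dots> \<le> (real (card K))\<^sup>2 * (2 / 2 ^ d)"
    by (intro mult_left_mono sum_half_powers_le) auto
  finally show ?thesis by (simp add: mult.commute)
qed

section \<open>Data structures with a random seed\<close>

lemma contents_snoc: "contents (as @ [a]) = apply_op (contents as) a"
  by (simp add: contents_def)

lemma legal_from_append:
  "legal_from n v U M (as @ bs) \<longleftrightarrow> legal_from n v U M as \<and> legal_from n v U (foldl apply_op M as) bs"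
  by (induction as arbitrary: M) auto

lemma legal_snoc: "legal n v U (as @ [a]) \<longleftrightarrow> legal n v U as \<and> legal_op n v U (contents as) a"
  by (simp add: legal_def contents_def legal_from_append)

lemma dom_apply_op_subset: "dom M \<subseteq> U \<Longrightarrow> legal_op n v U M a \<Longrightarrow> dom (apply_op M a) \<subseteq> U"
  by (cases a) auto

lemma ran_apply_op_subset:
  "ran M \<subseteq> {x. length x = v} \<Longrightarrow> legal_op n v U M a \<Longrightarrow> ran (apply_op M a) \<subseteq> {x. length x = v}"
  by (cases a) (auto simp: ran_def split: if_splits)

lemma legal_contents:
  "legal n v U as \<Longrightarrow>
    dom (contents as) \<subseteq> U \<and> finite (dom (contents as)) \<and> card (dom (contents as)) \<le> n"
proof (induction as rule: rev_induct)
  case Nil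
  then show ?case by (simp add: contents_def)
next
  case (snoc a as)
  then show ?case
    by (cases a)
      (auto simp: legal_snoc contents_snoc card_insert_if insert_absorb simp del: fun_upd_apply)
qed

locale seeded_simulation =
  fixes n v :: nat and U :: "'k set" and S :: "'s pmf" and z\<^sub>0 :: 'z
    and step :: "'s \<Rightarrow> 'k operation \<Rightarrow> 'z \<Rightarrow> 'z" and query :: "'s \<Rightarrow> 'z \<Rightarrow> 'k \<Rightarrow> bits"
    and code :: "'s \<times> 'z \<Rightarrow> bits" and sim :: "'s \<Rightarrow> 'z \<Rightarrow> ('k \<rightharpoonup> bits) \<Rightarrow> bool"
  assumes sim_init: "s \<in> set_pmf S \<Longrightarrow> sim s z\<^sub>0 Map.empty"
    and sim_step:
      "s \<in> set_pmf S \<Longrightarrow> sim s z M \<Longrightarrow> legal_op n v U M a \<Longrightarrow> sim s (step s a z) (apply_op M a)"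
    and sim_query: "sim s z M \<Longrightarrow> M k = Some x \<Longrightarrow> query s z k = x"
    and inj_on_code: "inj_on code {(s, z). s \<in> set_pmf S \<and> (\<exists>M. sim s z M)}"
begin

definition decode :: "bits \<Rightarrow> 's \<times> 'z" where
  "decode = inv_into {(s, z). s \<in> set_pmf S \<and> (\<exists>M. sim s z M)} code"

definition exec :: "'k operation \<Rightarrow> bits \<Rightarrow> bits pmf" where
  "exec a b = return_pmf (case decode b of (s, z) \<Rightarrow> code (s, step s a z))"

definition ds :: "'k retrieval_ds" where
  "ds = \<lparr>ds_init = map_pmf (\<lambda>s. code (s, z\<^sub>0)) S, ds_insert = (\<lambda>k x. exec (Insert k x)),
    ds_update = (\<lambda>k x. exec (Update k x)),
    ds_query = (\<lambda>k b. case decode b of (s, z) \<Rightarrow> query s z k)\<rparr>"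

definition run :: "'k operation list \<Rightarrow> 's \<Rightarrow> 'z" where
  "run as s = foldl (\<lambda>z a. step s a z) z\<^sub>0 as"

lemma run_Nil: "run [] s = z\<^sub>0"
  by (simp add: run_def)

lemma run_snoc: "run (as @ [a]) s = step s a (run as s)"
  by (simp add: run_def)

lemma decode_code: "s \<in> set_pmf S \<Longrightarrow> sim s z M \<Longrightarrow> decode (code (s, z)) = (s, z)"
  unfolding decode_def using inj_on_code by (intro inv_into_f_f) auto

lemma sim_run: "s \<in> set_pmf S \<Longrightarrow> legal n v U as \<Longrightarrow> sim s (run as s) (contents as)"
proof (induction as rule: rev_induct)
  case Nil
  then show ?case using sim_init by (simp add: run_Nil contents_def)
next
  case (snoc a as)
  then show ?case by (simp add: legal_snoc run_snoc contents_snoc sim_step)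
qed

lemma memory_after_ds: "legal n v U as \<Longrightarrow> memory_after ds as = map_pmf (\<lambda>s. code (s, run as s)) S"
proof (induction as rule: rev_induct)
  case Nil
  then show ?case by (simp add: memory_after_def ds_def run_Nil)
next
  case (snoc a as)
  then have legal: "legal n v U as" by (simp add: legal_snoc)
  have "exec_op ds a = exec a" by (cases a) (auto simp: ds_def fun_eq_iff)
  then have "memory_after ds (as @ [a]) = bind_pmf (memory_after ds as) (exec a)"
    by (simp add: memory_after_def)
  also have "\<dots> = bind_pmf S (\<lambda>s. exec a (code (s, run as s)))"
    using snoc.IH[OF legal] by (simp add: bind_map_pmf)
  also have "\<dots> = bind_pmf S (\<lambda>s. return_pmf (code (s, run (as @ [a]) s)))"
    by (intro bind_pmf_cong) (auto simp: exec_def decode_code[OF _ sim_run[OF _ legal]] run_snoc)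
  finally show ?case by (simp add: map_pmf_def)
qed

lemma incremental_retrieval_ds: "incremental_retrieval n v U ds"
  unfolding incremental_retrieval_def
proof (intro allI impI ballI)
  fix as b k x
  assume legal: "legal n v U as" and "b \<in> set_pmf (memory_after ds as)"
    and stored: "contents as k = Some x"
  then obtain s where seed: "s \<in> set_pmf S" "b = code (s, run as s)" by (auto simp: memory_after_ds)
  note sim = sim_run[OF seed(1) legal]
  show "ds_query ds k b = x"
    using sim_query[OF sim stored] decode_code[OF seed(1) sim] seed(2) by (simp add: ds_def)
qed

lemma expected_size_ds:
  assumes "legal n v U as" "finite (set_pmf S)"
  shows "expected_size ds as =
    ennreal (measure_pmf.expectation S (\<lambda>s. real (length (code (s, run as s)))))"
  unfolding expected_size_def memory_after_ds[OF assms(1)] using assms(2)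
  by (simp add: ennreal_of_nat_eq_real_of_nat nn_integral_eq_integral integrable_measure_pmf_finite)

end

section \<open>Tries with exceptions\<close>

type_synonym ('k, 'v) exception_trie = "'v trie \<times> ('k \<times> 'v) list"

text \<open>\<open>es\<close> lists the exceptions; every other key owns a leaf of \<open>T\<close>.\<close>

definition stores :: "('k \<Rightarrow> bits) \<Rightarrow> nat \<Rightarrow> ('k, 'v) exception_trie \<Rightarrow> ('k \<rightharpoonup> 'v) \<Rightarrow> bool" where
  "stores h d = (\<lambda>(T, es) M. distinct (map fst es) \<and> fst ` set es \<subseteq> dom M \<and>
     (\<exists>N. represents d T N \<and> bij_betw h (dom M - fst ` set es) (dom N) \<and>
       (\<forall>k\<in>dom M. M k = ((N \<circ> h) ++ map_of es) k)))"

lemma storesI: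
  assumes "distinct (map fst es)" "fst ` set es \<subseteq> dom M" "represents d T N"
    and "bij_betw h (dom M - fst ` set es) (dom N)"
    and "\<forall>k\<in>dom M. M k = ((N \<circ> h) ++ map_of es) k"
  shows "stores h d (T, es) M"
  using assms unfolding stores_def by auto

lemma storesE:
  assumes "stores h d (T, es) M"
  obtains N where "distinct (map fst es)" "fst ` set es \<subseteq> dom M" "represents d T N"
    "bij_betw h (dom M - fst ` set es) (dom N)" "\<forall>k\<in>dom M. M k = ((N \<circ> h) ++ map_of es) k"
  using assms unfolding stores_def by blast

lemma stores_empty: "stores h d (Empty, []) Map.empty"
  by (rule storesI[where N = Map.empty]) (auto simp: bij_betw_def)

lemma stores_finite_dom:
  assumes "stores h d z M"
  shows "finite (dom M)"
proof -
  obtain T es where z_eq: "z = (T, es)" by (cases z)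
  obtain N where "represents d T N" and bij: "bij_betw h (dom M - fst ` set es) (dom N)"
    using assms unfolding z_eq by (elim storesE) blast
  then have "finite (dom M - fst ` set es)"
    using bij_betw_finite[OF bij] represents_finite by blast
  then show ?thesis by simp
qed

fun key_count :: "('k, 'v) exception_trie \<Rightarrow> nat" where
  "key_count (T, es) = length (trie_values T) + length es"

lemma stores_key_count:
  assumes "stores h d z M"
  shows "key_count z = card (dom M)"
proof -
  obtain T es where z_eq: "z = (T, es)" by (cases z)
  obtain N where exceptions: "distinct (map fst es)" "fst ` set es \<subseteq> dom M"
    and rep: "represents d T N"
    and bij: "bij_betw h (dom M - fst ` set es) (dom N)"
    using assms unfolding z_eq by (elim storesE) blast
  have "length es = card (fst ` set es)"
    using exceptions(1) by (metis distinct_card length_map set_map)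
  moreover have "length (trie_values T) = card (dom M - fst ` set es)"
    using represents_trie_values[OF rep] bij_betw_same_card[OF bij] by simp
  ultimately show ?thesis
    using exceptions(2) card_mono[OF stores_finite_dom[OF assms] exceptions(2)]
    by (simp add: z_eq card_Diff_subset)
qed

lemma stores_values:
  assumes "stores h d (T, es) M"
  shows "set (trie_values T) \<subseteq> ran M" "set es \<subseteq> dom M \<times> ran M"
proof -
  obtain N where exceptions: "distinct (map fst es)" "fst ` set es \<subseteq> dom M"
    and rep: "represents d T N"
    and bij: "bij_betw h (dom M - fst ` set es) (dom N)"
    and M_eq: "\<forall>k\<in>dom M. M k = ((N \<circ> h) ++ map_of es) k"
    using assms by (elim storesE) blast
  have "x \<in> ran M" if N_xs: "N xs = Some x" for xs x
  proof -
    obtain k where owner: "k \<in> dom M - fst ` set es" "xs = h k"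
      using N_xs bij_betw_imp_surj_on[OF bij] by blast
    moreover from owner(1) have "map_of es k = None" by (simp add: map_of_eq_None_iff)
    ultimately have "M k = Some x" using M_eq N_xs by (simp add: map_add_def)
    then show ?thesis by (rule ranI)
  qed
  then show "set (trie_values T) \<subseteq> ran M"
    using represents_trie_values[OF rep] by (auto simp: ran_def)
  show "set es \<subseteq> dom M \<times> ran M"
  proof (rule subrelI)
    fix k x assume "(k, x) \<in> set es"
    moreover from this have "k \<in> dom M" using exceptions(2) by force
    ultimately have "M k = Some x" using exceptions(1) M_eq by simp
    then show "(k, x) \<in> dom M \<times> ran M" by (auto intro: ranI)
  qed
qed

lemma stores_trie_lookup_prefix:
  assumes "stores h d (T, es) M" "trie_lookup T (h k) \<noteq> None"
  shows "\<exists>k'\<in>dom M. take d (h k') = take d (h k)"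
proof -
  obtain N where rep: "represents d T N" and bij: "bij_betw h (dom M - fst ` set es) (dom N)"
    using assms(1) by (elim storesE) blast
  obtain ys where "ys \<in> dom N" "take d ys = take d (h k)"
    using represents_trie_lookup_prefix[OF rep] assms(2) by blast
  moreover have "dom N \<subseteq> h ` dom M" using bij_betw_imp_surj_on[OF bij] by blast
  ultimately show ?thesis by force
qed

lemma stores_card_inner_nodes_le:
  assumes "stores h d (T, es) M"
  shows "card (inner_nodes T) \<le> 2 ^ l + card (dom M) * (d - l) + card (collisions h d (dom M))"
proof -
  obtain N where rep: "represents d T N" and bij: "bij_betw h (dom M - fst ` set es) (dom N)"
    using assms by (elim storesE) blast
  note fin = stores_finite_dom[OF assms]
  have "card (dom N) \<le> card (dom M)"
    unfolding bij_betw_same_card[OF bij, symmetric] using fin by (intro card_mono) auto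
  then have "card (dom N) * (d - l) \<le> card (dom M) * (d - l)" by (rule mult_le_mono1)
  moreover have "dom N \<subseteq> h ` dom M" using bij_betw_imp_surj_on[OF bij] by blast
  note card_inner_nodes_le[OF rep fin this, of l]
  ultimately show ?thesis by linarith
qed

lemma stores_prune: "stores h d' (T, es) M \<Longrightarrow> d \<le> d' \<Longrightarrow> stores h d (prune d T, es) M"
  by (auto elim!: storesE intro!: storesI represents_prune)

lemma stores_exception_update:
  assumes "stores h d (T, es) M" "k \<notin> dom M \<or> k \<in> fst ` set es"
  shows "stores h d (T, AList.update k x es) (M(k \<mapsto> x))"
proof -
  obtain N where "distinct (map fst es)" "fst ` set es \<subseteq> dom M" "represents d T N"
    "bij_betw h (dom M - fst ` set es) (dom N)" "\<forall>k\<in>dom M. M k = ((N \<circ> h) ++ map_of es) k"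
    using assms(1) by (elim storesE) blast
  moreover have "dom (M(k \<mapsto> x)) - fst ` set (AList.update k x es) = dom M - fst ` set es"
    using assms(2) by (auto simp: dom_update)
  ultimately show ?thesis
    by (intro storesI[where N = N]) (auto simp: dom_update update_conv' distinct_update)
qed

lemma bij_betw_insert_same:
  assumes "bij_betw f A B" "f a \<notin> B \<or> a \<in> A"
  shows "bij_betw f (insert a A) (insert (f a) B)"
proof (cases "a \<in> A")
  case True
  then have "f a \<in> B" using bij_betwE[OF assms(1)] by blast
  with True show ?thesis using assms(1) by (simp add: insert_absorb)
next
  case False
  then show ?thesis using assms notIn_Un_bij_betw[of a A f B] by simp
qed

lemma stores_trie_update:
  assumes "stores h d (T, es) M"
    and new: "trie_lookup T (h k) = None \<or> k \<in> dom M" "k \<notin> fst ` set es"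
    and len: "d \<le> length (h k)" "\<And>k'. k' \<in> dom M \<Longrightarrow> length (h k') = length (h k)"
  shows "stores h d (trie_update d (h k) x T, es) (M(k \<mapsto> x))"
proof -
  let ?owners = "dom M - fst ` set es"
  obtain N where exceptions: "distinct (map fst es)" "fst ` set es \<subseteq> dom M"
    and rep: "represents d T N"
    and bij: "bij_betw h ?owners (dom N)" and M_eq: "\<forall>k\<in>dom M. M k = ((N \<circ> h) ++ map_of es) k"
    using assms(1) by (elim storesE) blast
  have "h k \<notin> dom N \<or> k \<in> ?owners" using new represents_trie_lookup[OF rep] by fastforce
  then have bij_upd: "bij_betw h (insert k ?owners) (insert (h k) (dom N))"
    by (rule bij_betw_insert_same[OF bij])
  then have "h k' \<noteq> h k" if "k' \<in> dom M" "map_of es k' = None" "k' \<noteq> k" for k'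
    using that by (auto simp: bij_betw_def inj_on_def map_of_eq_None_iff)
  moreover have "map_of es k = None" using new(2) by (simp add: map_of_eq_None_iff)
  ultimately have M_upd_eq:
    "\<forall>k'\<in>dom (M(k \<mapsto> x)). (M(k \<mapsto> x)) k' = ((N(h k \<mapsto> x) \<circ> h) ++ map_of es) k'"
    using M_eq by (auto simp: map_add_def split: option.splits)
  have "dom N \<subseteq> {ys. length ys = length (h k)}"
    using len(2) unfolding bij_betw_imp_surj_on[OF bij, symmetric] by auto
  moreover have "trie_lookup T (h k) = None \<or> h k \<in> dom N" using new bij_betwE[OF bij] by blast
  ultimately have "represents d (trie_update d (h k) x T) (N(h k \<mapsto> x))"
    using len(1) by (intro represents_trie_update rep)
  moreover have "insert k (dom M) - fst ` set es = insert k ?owners" using new(2) by auto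
  then have "bij_betw h (dom (M(k \<mapsto> x)) - fst ` set es) (dom (N(h k \<mapsto> x)))"
    using bij_upd by (simp only: dom_fun_upd option.simps if_False)
  moreover have "fst ` set es \<subseteq> dom (M(k \<mapsto> x))" using exceptions(2) by auto
  ultimately show ?thesis
    using exceptions(1) M_upd_eq by (intro storesI[where N = "N(h k \<mapsto> x)"])
qed

fun retrieval_query :: "('k \<Rightarrow> bits) \<Rightarrow> ('k, 'v) exception_trie \<Rightarrow> 'k \<Rightarrow> 'v" where
  "retrieval_query h (T, es) k =
     (case map_of es k of Some x \<Rightarrow> x | None \<Rightarrow> the (trie_lookup T (h k)))"

fun retrieval_insert ::
  "('k \<Rightarrow> bits) \<Rightarrow> nat \<Rightarrow> 'k \<Rightarrow> 'v \<Rightarrow> ('k, 'v) exception_trie \<Rightarrow> ('k, 'v) exception_trie" where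
  "retrieval_insert h d k x (T, es) =
     (if trie_lookup (prune d T) (h k) = None then (trie_update d (h k) x (prune d T), es)
      else (prune d T, AList.update k x es))"

fun retrieval_update ::
  "('k \<Rightarrow> bits) \<Rightarrow> nat \<Rightarrow> 'k \<Rightarrow> 'v \<Rightarrow> ('k, 'v) exception_trie \<Rightarrow> ('k, 'v) exception_trie" where
  "retrieval_update h d k x (T, es) =
     (if k \<in> fst ` set es then (T, AList.update k x es) else (trie_update d (h k) x T, es))"

lemma stores_retrieval_query:
  assumes "stores h d z M" "M k = Some x"
  shows "retrieval_query h z k = x"
proof -
  obtain T es where z_eq: "z = (T, es)" by (cases z)
  obtain N where rep: "represents d T N" and "\<forall>k\<in>dom M. M k = ((N \<circ> h) ++ map_of es) k"
    using assms(1) unfolding z_eq by (elim storesE) blast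
  then have "Some x = ((N \<circ> h) ++ map_of es) k" using assms(2) by force
  then have "map_of es k = Some x \<or> map_of es k = None \<and> N (h k) = Some x"
    by (auto simp: map_add_def split: option.splits)
  then show ?thesis using represents_trie_lookup[OF rep] z_eq by auto
qed

lemma stores_retrieval_insert:
  assumes stores: "stores h d' z M" and "d \<le> d'" "k \<notin> dom M"
    and len: "d \<le> length (h k)" "\<And>k'. k' \<in> dom M \<Longrightarrow> length (h k') = length (h k)"
  shows "stores h d (retrieval_insert h d k x z) (M(k \<mapsto> x))"
proof -
  obtain T es where z_eq: "z = (T, es)" by (cases z)
  have pruned: "stores h d (prune d T, es) M"
    using stores \<open>d \<le> d'\<close> unfolding z_eq by (rule stores_prune)
  then have "k \<notin> fst ` set es" using \<open>k \<notin> dom M\<close> by (elim storesE) blast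
  then have "stores h d (trie_update d (h k) x (prune d T), es) (M(k \<mapsto> x))"
    if "trie_lookup (prune d T) (h k) = None"
    using that len by (intro stores_trie_update[OF pruned] disjI1)
  moreover have "stores h d (prune d T, AList.update k x es) (M(k \<mapsto> x))"
    using \<open>k \<notin> dom M\<close> by (intro stores_exception_update[OF pruned] disjI1)
  ultimately show ?thesis unfolding z_eq retrieval_insert.simps
    by (cases "trie_lookup (prune d T) (h k) = None") (simp_all only: if_True if_False simp_thms)
qed

lemma stores_retrieval_update:
  assumes stores: "stores h d z M" and "k \<in> dom M"
    and len: "d \<le> length (h k)" "\<And>k'. k' \<in> dom M \<Longrightarrow> length (h k') = length (h k)"
  shows "stores h d (retrieval_update h d k x z) (M(k \<mapsto> x))"
proof -
  obtain T es where z_eq: "z = (T, es)" by (cases z)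
  note stores = stores[unfolded z_eq]
  have "stores h d (T, AList.update k x es) (M(k \<mapsto> x))" if "k \<in> fst ` set es"
    using that by (intro stores_exception_update[OF stores] disjI2)
  moreover have "stores h d (trie_update d (h k) x T, es) (M(k \<mapsto> x))" if "k \<notin> fst ` set es"
    using \<open>k \<in> dom M\<close> that len by (intro stores_trie_update[OF stores] disjI2)
  ultimately show ?thesis unfolding z_eq retrieval_update.simps
    by (cases "k \<in> fst ` set es") (simp_all only: if_True if_False simp_thms)
qed

lemma length_exceptions_insert_le:
  assumes "stores h d' z M" "d \<le> d'" "k \<notin> dom M"
  shows "length (snd (retrieval_insert h d k x z)) \<le>
    length (snd z) + of_bool (\<exists>k'\<in>dom M. take d (h k') = take d (h k))"
proof -
  obtain T es where z_eq: "z = (T, es)" by (cases z)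
  have pruned: "stores h d (prune d T, es) M" using assms(1,2) unfolding z_eq by (rule stores_prune)
  then have "k \<notin> fst ` set es" using \<open>k \<notin> dom M\<close> by (elim storesE) blast
  then have "length (AList.update k x es) = Suc (length es)" by (induction es) auto
  then show ?thesis using stores_trie_lookup_prefix[OF pruned, of k] unfolding z_eq by auto
qed

lemma length_exceptions_update: "length (snd (retrieval_update h d k x z)) = length (snd z)"
proof -
  have "length (AList.update k x es) = length es" if "k \<in> fst ` set es" for es
    using that by (induction es) auto
  then show ?thesis by (cases z) simp
qed

fun retrieval_step :: "(nat \<Rightarrow> nat) \<Rightarrow> ('k \<Rightarrow> bits) \<Rightarrow> 'k operation \<Rightarrow>
    ('k, bits) exception_trie \<Rightarrow> ('k, bits) exception_trie" where
  "retrieval_step D h (Insert k x) z = retrieval_insert h (D (Suc (key_count z))) k x z"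
| "retrieval_step D h (Update k x) z = retrieval_update h (D (key_count z)) k x z"

lemma stores_retrieval_step:
  assumes stores: "stores h (D (card (dom M))) z M" and "antimono D"
    and len: "\<And>k. k \<in> U \<Longrightarrow> length (h k) = D 0" and "dom M \<subseteq> U" "legal_op n v U M a"
  shows "stores h (D (card (dom (apply_op M a)))) (retrieval_step D h a z) (apply_op M a)"
proof -
  note count = stores_key_count[OF stores] and fin = stores_finite_dom[OF stores]
  have D_le: "D i \<le> D 0" "D (Suc i) \<le> D i" for i using \<open>antimono D\<close> by (auto intro: antimonoD)
  show ?thesis
  proof (cases a)
    case (Insert k x)
    then have key: "k \<in> U" "k \<notin> dom M" using assms(5) by auto
    then have "card (dom (apply_op M a)) = Suc (card (dom M))" using Insert fin by simp
    moreover have "stores h (D (Suc (card (dom M))))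
        (retrieval_insert h (D (Suc (card (dom M)))) k x z) (M(k \<mapsto> x))"
      using key len D_le \<open>dom M \<subseteq> U\<close>
      by (intro stores_retrieval_insert[OF stores]) (auto simp: subset_iff)
    ultimately show ?thesis using Insert count by (simp only: retrieval_step.simps apply_op.simps)
  next
    case (Update k x)
    then have key: "k \<in> dom M" using assms(5) by simp
    then have "dom (apply_op M a) = dom M" using Update by auto
    moreover have "stores h (D (card (dom M)))
        (retrieval_update h (D (card (dom M))) k x z) (M(k \<mapsto> x))"
      using key len D_le \<open>dom M \<subseteq> U\<close>
      by (intro stores_retrieval_update[OF stores]) (auto simp: subset_iff)
    ultimately show ?thesis using Update count by (simp only: retrieval_step.simps apply_op.simps)
  qed
qed

locale hashed_trie =
  fixes n v :: nat and U :: "'k set" and S :: "'s pmf" and h :: "'s \<Rightarrow> 'k \<Rightarrow> bits"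
    and D :: "nat \<Rightarrow> nat" and seed_code :: "'s \<Rightarrow> bits" and key_code :: "'k \<Rightarrow> bits"
  assumes hash: "universal_hash U (D 0) S h" and antimono_D: "antimono D"
    and prefix_code_seed: "prefix_code seed_code (set_pmf S)"
    and prefix_code_key: "prefix_code key_code U"
begin

definition state_code :: "'s \<times> ('k, bits) exception_trie \<Rightarrow> bits" where
  "state_code = pair_code seed_code (pair_code (trie_code id) (list_code (pair_code key_code id)))"

definition sim :: "'s \<Rightarrow> ('k, bits) exception_trie \<Rightarrow> ('k \<rightharpoonup> bits) \<Rightarrow> bool" where
  "sim s z M \<longleftrightarrow> stores (h s) (D (card (dom M))) z M \<and> dom M \<subseteq> U \<and> ran M \<subseteq> {x. length x = v}"

lemma length_hash: "s \<in> set_pmf S \<Longrightarrow> k \<in> U \<Longrightarrow> length (h s k) = D 0"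
  using hash unfolding universal_hash_def by blast

lemma finite_seeds: "finite (set_pmf S)"
  using hash by (simp add: universal_hash_def)

lemma integrable_seed: "integrable (measure_pmf S) (f :: 's \<Rightarrow> real)"
  by (rule integrable_measure_pmf_finite[OF finite_seeds])

lemma D_Suc_le: "D (Suc i) \<le> D i"
  using antimono_D by (rule antimonoD) simp

lemma prefix_code_state_code:
  "prefix_code state_code
    (set_pmf S \<times> {T. set (trie_values T) \<subseteq> {x. length x = v}} \<times> lists (U \<times> {x. length x = v}))"
proof -
  have "prefix_code id {x :: bits. length x = v}" by (rule prefix_code_fixed_length) auto
  then show ?thesis unfolding state_code_def
    by (intro prefix_code_pair_code prefix_code_trie_code prefix_code_list_code
        prefix_code_seed prefix_code_key)
qed

lemma sim_values:
  assumes "sim s (T, es) M"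
  shows "set (trie_values T) \<subseteq> {x. length x = v}" "set es \<subseteq> U \<times> {x. length x = v}"
  using assms stores_values[of "h s" _ T es M] unfolding sim_def by blast+

sublocale seeded_simulation n v U S "(Empty, [])" "\<lambda>s. retrieval_step D (h s)"
  "\<lambda>s. retrieval_query (h s)" state_code sim
proof
  show "sim s (Empty, []) Map.empty" for s by (simp add: sim_def stores_empty)
  show "sim s (retrieval_step D (h s) a z) (apply_op M a)"
    if "s \<in> set_pmf S" "sim s z M" "legal_op n v U M a" for s z M a
    using that stores_retrieval_step[of "h s" D M z U n v a] length_hash antimono_D
      dom_apply_op_subset[of M U n v a] ran_apply_op_subset[of M v n U a]
    unfolding sim_def by blast
  show "retrieval_query (h s) z k = x" if "sim s z M" "M k = Some x" for s z M k x
    using that stores_retrieval_query[of "h s" "D (card (dom M))" z M k x] by (simp add: sim_def)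
  show "inj_on state_code {(s, z). s \<in> set_pmf S \<and> (\<exists>M. sim s z M)}"
  proof (rule inj_on_subset[OF prefix_code_inj_on[OF prefix_code_state_code]], rule subsetI)
    fix p assume "p \<in> {(s, z). s \<in> set_pmf S \<and> (\<exists>M. sim s z M)}"
    then obtain s T es M where p: "p = (s, T, es)" "s \<in> set_pmf S" "sim s (T, es) M" by auto
    then show "p \<in> set_pmf S \<times> {T. set (trie_values T) \<subseteq> {x. length x = v}} \<times>
        lists (U \<times> {x. length x = v})"
      using sim_values[OF p(3)] by auto
  qed
qed

abbreviation exception_count :: "'k operation list \<Rightarrow> 's \<Rightarrow> nat" where
  "exception_count as s \<equiv> length (snd (run as s))"

lemma stores_run:
  assumes "s \<in> set_pmf S" "legal n v U as"
  shows "stores (h s) (D (card (dom (contents as)))) (run as s) (contents as)"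
  using sim_run[OF assms] by (simp add: sim_def)

lemma key_count_run:
  assumes "s \<in> set_pmf S" "legal n v U as"
  shows "key_count (run as s) = card (dom (contents as))"
  using stores_run[OF assms] by (rule stores_key_count)

lemma expectation_exceptions_insert_le:
  assumes legal: "legal n v U as" and new_key: "k \<in> U" "k \<notin> dom (contents as)"
  defines "d \<equiv> D (Suc (card (dom (contents as))))"
  shows "measure_pmf.expectation S (\<lambda>s. real (exception_count (as @ [Insert k x]) s)) \<le>
    measure_pmf.expectation S (\<lambda>s. real (exception_count as s)) + real n / 2 ^ d"
proof -
  let ?K = "dom (contents as)"
  define agree where "agree = {s. \<exists>k'\<in>?K. take d (h s k') = take d (h s k)}"
  have insert_le:
    "exception_count (as @ [Insert k x]) s \<le> exception_count as s + of_bool (s \<in> agree)"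
    if "s \<in> set_pmf S" for s
    using length_exceptions_insert_le[OF stores_run[OF that legal] D_Suc_le new_key(2), of x]
    by (simp add: run_snoc key_count_run[OF that legal] d_def agree_def)
  have "real (exception_count (as @ [Insert k x]) s) \<le>
      real (exception_count as s) + indicator agree s" if "s \<in> set_pmf S" for s
    using insert_le[OF that] by (cases "s \<in> agree") simp_all
  then have "measure_pmf.expectation S (\<lambda>s. real (exception_count (as @ [Insert k x]) s)) \<le>
      measure_pmf.expectation S (\<lambda>s. real (exception_count as s) + indicator agree s)"
    by (intro integral_mono_AE integrable_seed) (simp add: AE_measure_pmf_iff)
  also have "\<dots> =
      measure_pmf.expectation S (\<lambda>s. real (exception_count as s)) + measure_pmf.prob S agree"
    by (subst Bochner_Integration.integral_add) (auto intro: integrable_seed)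
  also have "measure_pmf.prob S agree \<le> real (card ?K) / 2 ^ d"
    using legal_contents[OF legal] new_key antimonoD[OF antimono_D] unfolding agree_def d_def
    by (intro prob_prefix_collision_le[OF hash]) auto
  also have "\<dots> \<le> real n / 2 ^ d" using legal_contents[OF legal] by (intro divide_right_mono) auto
  finally show ?thesis by simp
qed

lemma expectation_exceptions_le:
  "legal n v U as \<Longrightarrow> measure_pmf.expectation S (\<lambda>s. real (exception_count as s)) \<le>
    (\<Sum>j<card (dom (contents as)). real n / 2 ^ D (Suc j))"
proof (induction as rule: rev_induct)
  case Nil
  then show ?case by (simp add: run_Nil contents_def)
next
  case (snoc a as)
  then have legal: "legal n v U as" and legal_a: "legal_op n v U (contents as) a"
    by (auto simp: legal_snoc)
  show ?case
  proof (cases a)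
    case (Insert k x)
    then have new_key: "k \<in> U" "k \<notin> dom (contents as)" using legal_a by auto
    then have "card (dom (contents (as @ [a]))) = Suc (card (dom (contents as)))"
      using Insert legal_contents[OF legal] by (simp add: contents_snoc)
    then show ?thesis
      using expectation_exceptions_insert_le[OF legal new_key, of x] snoc.IH[OF legal] Insert
      by simp
  next
    case (Update k x)
    then have "dom (contents (as @ [a])) = dom (contents as)"
      using legal_a by (auto simp: contents_snoc)
    then show ?thesis
      using snoc.IH[OF legal] Update by (simp add: run_snoc length_exceptions_update)
  qed
qed

lemma expectation_run_collisions_le:
  assumes "legal n v U as" "n \<le> 2 ^ d"
  defines "K \<equiv> dom (contents as)"
  shows "measure_pmf.expectation S (\<lambda>s. real (card (collisions (h s) d K))) \<le> 2 * real n"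
proof -
  have stored_keys: "finite K" "K \<subseteq> U" "card K \<le> n"
    using legal_contents[OF assms(1)] by (auto simp: K_def)
  then have "card K * card K \<le> n * 2 ^ d" using assms(2) by (intro mult_le_mono) linarith+
  then have "real (card K * card K) \<le> real (n * 2 ^ d)" by (simp only: of_nat_le_iff)
  then have "2 * (real (card K))\<^sup>2 / 2 ^ d \<le> 2 * real n" by (simp add: power2_eq_square field_simps)
  moreover have "measure_pmf.expectation S (\<lambda>s. real (card (collisions (h s) d K))) \<le>
      2 * (real (card K))\<^sup>2 / 2 ^ d"
    using stored_keys by (intro expectation_collisions_le[OF hash])
  ultimately show ?thesis by linarith
qed

lemma length_state_code:
  assumes "sim s (T, es) M" and key_len: "\<And>k. k \<in> U \<Longrightarrow> length (key_code k) = \<kappa>"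
  shows "length (state_code (s, T, es)) = length (seed_code s) +
    3 * card (inner_nodes T) + 3 + card (dom M) * v + length es * (\<kappa> + 1)"
proof -
  note state_values = sim_values[OF assms(1)]
  have "length (trie_code id T) = 3 * card (inner_nodes T) + 2 + length (trie_values T) * v"
    using state_values(1) by (intro length_trie_code) auto
  moreover have "length (list_code (pair_code key_code id) es) = 1 + length es * (1 + (\<kappa> + v))"
    using state_values(2) key_len by (intro length_list_code) (auto simp: pair_code_def)
  moreover have "card (dom M) = length (trie_values T) + length es"
    using assms(1) stores_key_count[of "h s" "D (card (dom M))" "(T, es)" M] by (simp add: sim_def)
  ultimately show ?thesis by (simp add: state_code_def pair_code_def algebra_simps)
qed

lemma length_state_code_run_le:
  assumes seed: "s \<in> set_pmf S" and legal: "legal n v U as"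
    and key_len: "\<And>k. k \<in> U \<Longrightarrow> length (key_code k) = \<kappa>"
  defines "i \<equiv> card (dom (contents as))"
  shows "length (state_code (s, run as s)) \<le>
    length (seed_code s) + 3 * (2 ^ l + i * (D i - l)) + 3 + i * v +
    3 * card (collisions (h s) (D i) (dom (contents as))) + (\<kappa> + 1) * exception_count as s"
proof -
  obtain T es where run: "run as s = (T, es)" by (cases "run as s")
  have "length (state_code (s, T, es)) = length (seed_code s) +
      3 * card (inner_nodes T) + 3 + i * v + length es * (\<kappa> + 1)"
    unfolding i_def using length_state_code[OF _ key_len] sim_run[OF seed legal] run by simp
  moreover have "card (inner_nodes T) \<le>
      2 ^ l + i * (D i - l) + card (collisions (h s) (D i) (dom (contents as)))"
    using stores_card_inner_nodes_le stores_run[OF seed legal] unfolding run i_def by blast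
  ultimately show ?thesis unfolding run by (simp add: algebra_simps)
qed

lemma expected_size_le:
  assumes legal: "legal n v U as"
    and seed_len: "\<And>s. s \<in> set_pmf S \<Longrightarrow> length (seed_code s) = c"
    and key_len: "\<And>k. k \<in> U \<Longrightarrow> length (key_code k) = \<kappa>"
  defines "i \<equiv> card (dom (contents as))"
  assumes "n \<le> 2 ^ D i"
  shows "expected_size ds as \<le> ennreal (real (c + 3 * (2 ^ l + i * (D i - l)) + 3 + i * v) +
    6 * real n + real (\<kappa> + 1) * (\<Sum>j<i. real n / 2 ^ D (Suc j)))"
proof -
  define B where "B = c + 3 * (2 ^ l + i * (D i - l)) + 3 + i * v"
  define C where "C s = card (collisions (h s) (D i) (dom (contents as)))" for s
  define X where "X s = exception_count as s" for s
  have "length (state_code (s, run as s)) \<le> B + 3 * C s + (\<kappa> + 1) * X s" if "s \<in> set_pmf S" for s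
    using length_state_code_run_le[OF that legal key_len] seed_len[OF that]
    unfolding B_def C_def X_def i_def by simp
  then have "real (length (state_code (s, run as s))) \<le> real (B + 3 * C s + (\<kappa> + 1) * X s)"
    if "s \<in> set_pmf S" for s
    using that by (simp only: of_nat_le_iff)
  then have "measure_pmf.expectation S (\<lambda>s. real (length (state_code (s, run as s)))) \<le>
      measure_pmf.expectation S (\<lambda>s. real (B + 3 * C s + (\<kappa> + 1) * X s))"
    by (intro integral_mono_AE integrable_seed) (simp add: AE_measure_pmf_iff)
  also have "\<dots> = real B + 3 * measure_pmf.expectation S C +
      real (\<kappa> + 1) * measure_pmf.expectation S X"
    by (simp add: integrable_seed algebra_simps)
  also have "\<dots> \<le> real B + 3 * (2 * real n) + real (\<kappa> + 1) * (\<Sum>j<i. real n / 2 ^ D (Suc j))"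
    using expectation_run_collisions_le[OF legal \<open>n \<le> 2 ^ D i\<close>] expectation_exceptions_le[OF legal]
    unfolding C_def X_def i_def by (intro add_mono mult_left_mono) auto
  finally show ?thesis
    unfolding expected_size_ds[OF legal finite_seeds] B_def by (intro ennreal_leI) simp
qed

end

section \<open>Choice of the parameters\<close>

text \<open>
  The cut-off depth falls by one about every \<open>3 n / w\<close> insertions, so that below depth \<open>e\<close>,
  \<open>i\<close> branches at three bits per level fit into \<open>(n - i) w\<close> bits.
\<close>

definition cutoff_depth :: "nat \<Rightarrow> nat \<Rightarrow> nat \<Rightarrow> nat \<Rightarrow> nat" where
  "cutoff_depth e n w i = e + (n - i) div (3 * n div w + 1)"

lemma antimono_cutoff_depth: "antimono (cutoff_depth e n w)"
  unfolding cutoff_depth_def by (intro antimonoI add_left_mono div_le_mono diff_le_mono2)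

lemma le_cutoff_depth: "e \<le> cutoff_depth e n w i"
  by (simp add: cutoff_depth_def)

lemma three_mult_le_mult_Suc_div: "0 < w \<Longrightarrow> 3 * n \<le> w * (3 * n div w + 1)" for n w :: nat
  using dividend_less_div_times[of w "3 * n"] by (simp add: algebra_simps)

lemma cutoff_depth_0_le:
  assumes "0 < w"
  shows "cutoff_depth e n w 0 \<le> e + w"
proof -
  define g where "g = 3 * n div w + 1"
  have "n div g \<le> w * g div g"
    using three_mult_le_mult_Suc_div[OF assms, of n] unfolding g_def by (intro div_le_mono) linarith
  also have "\<dots> = w" unfolding g_def by (rule nonzero_mult_div_cancel_right) simp
  finally show ?thesis by (simp add: cutoff_depth_def g_def)
qed

lemma cutoff_depth_cost_le:
  assumes "0 < w" "i \<le> n"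
  shows "3 * (i * (cutoff_depth e n w i - e)) + i * w \<le> n * w"
proof -
  define g where "g = 3 * n div w + 1"
  have "3 * i \<le> w * g"
    using three_mult_le_mult_Suc_div[OF assms(1), of n] assms(2) unfolding g_def by linarith
  then have "3 * i * ((n - i) div g) \<le> w * g * ((n - i) div g)" by (rule mult_le_mono1)
  also have "\<dots> \<le> w * (n - i)" by (simp add: mult.assoc)
  finally have "3 * i * ((n - i) div g) + i * w \<le> w * (n - i) + i * w" by (rule add_right_mono)
  also have "\<dots> = n * w" using assms(2) by (simp add: algebra_simps flip: add_mult_distrib2)
  finally show ?thesis unfolding cutoff_depth_def g_def by (simp add: mult.assoc)
qed

lemma sum_half_powers_div_le:
  assumes "0 < (g::nat)"
  shows "(\<Sum>r<n. 1 / 2 ^ (r div g)) \<le> 2 * real g"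
proof -
  have "n \<le> n * g" using assms by simp
  then have "(\<Sum>r<n. 1 / 2 ^ (r div g)) \<le> (\<Sum>r<n * g. 1 / (2::real) ^ (r div g))"
    by (intro sum_mono2) auto
  also have "\<dots> = (\<Sum>b<n. \<Sum>r = b * g..<b * g + g. 1 / 2 ^ (r div g))"
    by (rule sum.nat_group[symmetric])
  also have "\<dots> = (\<Sum>b<n. \<Sum>r = b * g..<b * g + g. 1 / 2 ^ b)"
  proof (intro sum.cong refl)
    fix b r assume "r \<in> {b * g..<b * g + g}"
    then have "r div g = b" by (intro div_nat_eqI) (auto simp: algebra_simps)
    then show "1 / 2 ^ (r div g) = 1 / (2::real) ^ b" by simp
  qed
  also have "\<dots> = real g * (\<Sum>b = 0..<n. 1 / 2 ^ b)"
    by (simp add: sum_distrib_left lessThan_atLeast0)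
  also have "\<dots> \<le> real g * 2"
    using sum_half_powers_le[of 0 n] by (intro mult_left_mono) auto
  finally show ?thesis by simp
qed

lemma sum_cutoff_depth_le:
  assumes "0 < w" "i \<le> n"
  shows "real w * (\<Sum>j<i. 2 ^ e / 2 ^ cutoff_depth e n w (Suc j)) \<le> 6 * real n + 2 * real w"
proof -
  define g where "g = 3 * n div w + 1"
  have "(\<Sum>j<i. 2 ^ e / 2 ^ cutoff_depth e n w (Suc j)) =
      (\<Sum>j<i. 1 / (2::real) ^ ((n - Suc j) div g))"
    by (simp add: cutoff_depth_def g_def power_add)
  also have "\<dots> \<le> (\<Sum>j<n. 1 / 2 ^ ((n - Suc j) div g))"
    using assms(2) by (intro sum_mono2) auto
  also have "\<dots> = (\<Sum>r<n. 1 / 2 ^ (r div g))" by (rule sum.nat_diff_reindex)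
  also have "\<dots> \<le> 2 * real g" unfolding g_def by (rule sum_half_powers_div_le) simp
  finally have "real w * (\<Sum>j<i. 2 ^ e / 2 ^ cutoff_depth e n w (Suc j)) \<le> real w * (2 * real g)"
    by (rule mult_left_mono) simp
  also have "\<dots> = 2 * real (w * g)" by simp
  also have "w * g \<le> 3 * n + w" unfolding g_def by (simp add: add_mult_distrib2)
  finally show ?thesis by simp
qed

lemma ex_scaled_power_two:
  fixes w x :: nat
  assumes "1 \<le> w" "w \<le> x"
  shows "\<exists>t. x \<le> w * 2 ^ t \<and> w * 2 ^ t \<le> 2 * x"
proof -
  have x_le: "x \<le> w * 2 ^ x" using assms by (metis less_exp less_imp_le mult_le_mono nat_mult_1)
  define t where "t = (LEAST t. x \<le> w * 2 ^ t)"
  have "x \<le> w * 2 ^ t" unfolding t_def using x_le by (rule LeastI)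
  moreover have "w * 2 ^ t \<le> 2 * x"
  proof (cases t)
    case 0
    then show ?thesis using assms by simp
  next
    case (Suc t')
    then have "t' < (LEAST t. x \<le> w * 2 ^ t)" unfolding t_def by simp
    then have "\<not> x \<le> w * 2 ^ t'" by (rule not_less_Least)
    then show ?thesis using Suc by simp
  qed
  ultimately show ?thesis by blast
qed

lemma Suc_square_le_power_two: "(n + 1)\<^sup>2 \<le> 4 * 2 ^ n" for n :: nat
proof -
  have "n + 1 \<le> 2 * (n div 2 + 1)" by simp
  also have "\<dots> \<le> 2 * 2 ^ (n div 2)" using less_exp[of "n div 2"] by (intro mult_le_mono2) linarith
  finally have "(n + 1)\<^sup>2 \<le> (2 * 2 ^ (n div 2))\<^sup>2" by (rule power_mono) simp
  also have "\<dots> = 4 * 2 ^ (2 * (n div 2))" by (simp add: power_mult_distrib power_even_eq)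
  also have "\<dots> \<le> 4 * 2 ^ n" by (intro mult_le_mono2 power_increasing) auto
  finally show ?thesis .
qed

text \<open>As \<open>log 2 0 = 0\<close>, this also holds for \<open>x = 0\<close>, which is needed for \<open>n = 1\<close>.\<close>

lemma log2_max_one:
  assumes "0 \<le> x"
  shows "log 2 (max 1 x) = max 0 (log 2 x)"
proof (cases "x = 0")
  case False
  with assms show ?thesis by (auto simp: max_def)
qed (simp add: log_def)

definition size_constant :: "nat \<Rightarrow> real" where
  "size_constant A = 32 * (real A)\<^sup>2 + 4 * real A + 3 * log 2 (3 * real A) + 24"

text \<open>Listing an exceptional key takes \<open>q\<close> bits, in addition to those of its value.\<close>

locale trie_parameters =
  fixes n v q l t w A :: nat
  assumes n_pos: "1 \<le> n" and v_pos: "1 \<le> v" and q_pos: "1 \<le> q"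
    and n_le: "n \<le> 2 ^ l" and power_l_le: "2 ^ l \<le> 2 * n" and q_le: "q \<le> A * (l + 1)"
    and w_def: "w = min v q" and q_le_scaled: "q \<le> w * 2 ^ t" and scaled_le: "w * 2 ^ t \<le> 2 * q"
begin

definition depth :: "nat \<Rightarrow> nat" where
  "depth = cutoff_depth (l + t) n w"

lemma w_pos: "1 \<le> w" and w_le: "w \<le> v" "w \<le> q"
  using v_pos q_pos by (auto simp: w_def)

lemma A_pos: "1 \<le> A"
  using q_pos q_le by (cases A) auto

lemma n_le_power_depth: "n \<le> 2 ^ depth i"
proof -
  have "l \<le> depth i" using le_cutoff_depth[of "l + t" n w i] by (simp add: depth_def)
  then have "(2::nat) ^ l \<le> 2 ^ depth i" by simp
  with n_le show ?thesis by (rule le_trans)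
qed

lemma seed_bits_le: "depth 0 * q \<le> 32 * A\<^sup>2 * n"
proof -
  define p where "p = A * (l + 1)"
  have q_le_p: "q \<le> p" unfolding p_def by (rule q_le)
  have "t < 2 ^ t" by (rule less_exp)
  also have "2 ^ t \<le> w * 2 ^ t" using w_pos by simp
  finally have "t \<le> 2 * q" using scaled_le by linarith
  moreover have "l + 1 \<le> p"
    unfolding p_def using mult_le_mono1[OF A_pos, of "l + 1"] by (simp only: mult_1)
  moreover have "depth 0 \<le> l + t + w"
    unfolding depth_def using w_pos by (intro cutoff_depth_0_le) simp
  ultimately have "depth 0 \<le> 4 * p" using w_le q_le_p by linarith
  then have "depth 0 * q \<le> 4 * p * p" using q_le_p by (rule mult_le_mono)
  also have "\<dots> = 4 * A\<^sup>2 * (l + 1)\<^sup>2" by (simp only: p_def power2_eq_square mult_ac)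
  also have "\<dots> \<le> 4 * A\<^sup>2 * (4 * (2 * n))"
    using Suc_square_le_power_two[of l] power_l_le by (intro mult_le_mono2) linarith
  finally show ?thesis by simp
qed

lemma trie_bits_le:
  assumes "i \<le> n"
  shows "3 * (2 ^ l + i * (depth i - l)) + 3 + i * v \<le> n * v + 3 * (n * t) + 9 * n"
proof -
  define b where "b = cutoff_depth (l + t) n w i - (l + t)"
  have depth: "depth i - l = t + b" by (simp add: depth_def b_def cutoff_depth_def)
  have "3 * (i * b) + i * w \<le> n * w"
    unfolding b_def using w_pos assms by (intro cutoff_depth_cost_le) auto
  moreover obtain u where "v = w + u" using le_Suc_ex[OF w_le(1)] by blast
  moreover have "i * u \<le> n * u" using assms by (rule mult_le_mono1)
  ultimately have "3 * (i * b) + i * v \<le> n * v" by (simp only: add_mult_distrib2)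
  moreover have "i * t \<le> n * t" using assms by (rule mult_le_mono1)
  ultimately show ?thesis
    using power_l_le n_pos unfolding depth add_mult_distrib2 by linarith
qed

lemma exception_bits_le:
  assumes "i \<le> n"
  shows "real q * (\<Sum>j<i. real n / 2 ^ depth (Suc j)) \<le> (4 * real A + 6) * real n"
proof -
  have "q * n \<le> w * 2 ^ t * 2 ^ l" using q_le_scaled n_le by (rule mult_le_mono)
  then have "real (q * n) \<le> real (w * 2 ^ t * 2 ^ l)" by (simp only: of_nat_le_iff)
  then have "real q * (real n / 2 ^ d) \<le> real w * (2 ^ (l + t) / 2 ^ d)" for d
    by (simp add: power_add divide_right_mono mult_ac)
  then have "real q * (\<Sum>j<i. real n / 2 ^ depth (Suc j)) \<le>
      real w * (\<Sum>j<i. 2 ^ (l + t) / 2 ^ depth (Suc j))"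
    unfolding sum_distrib_left by (intro sum_mono)
  also have "\<dots> \<le> 6 * real n + 2 * real w"
    unfolding depth_def using w_pos assms by (intro sum_cutoff_depth_le) auto
  also have "2 * real w \<le> 4 * real A * real n"
  proof -
    have "l + 1 \<le> 2 * n" using less_exp[of l] power_l_le by linarith
    then have "A * (l + 1) \<le> A * (2 * n)" by (rule mult_le_mono2)
    then have "2 * w \<le> 4 * A * n" using w_le(2) q_le by linarith
    then have "real (2 * w) \<le> real (4 * A * n)" by (simp only: of_nat_le_iff)
    then show ?thesis by simp
  qed
  finally show ?thesis by (simp add: algebra_simps)
qed

lemma q_le_log: "real q \<le> 3 * real A * max 1 (log 2 (real n))"
proof -
  have "real (2 ^ l) \<le> real (2 * n)" using power_l_le by (simp only: of_nat_le_iff)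
  then have "log 2 (2 ^ l) \<le> log 2 (2 * real n)" using n_pos by (subst log_le_cancel_iff) auto
  then have "real l + 1 \<le> 3 * max 1 (log 2 (real n))"
    using n_pos by (simp add: log_mult log_nat_power)
  then have "real A * (real l + 1) \<le> real A * (3 * max 1 (log 2 (real n)))"
    by (rule mult_left_mono) simp
  moreover have "real q \<le> real (A * (l + 1))" using q_le by (simp only: of_nat_le_iff)
  ultimately show ?thesis by (simp add: algebra_simps)
qed

lemma q_div_w_le: "real q / real w \<le> 3 * real A * max 1 (log 2 (real n) / real v)"
proof (cases "q \<le> v")
  case True
  then have "real q / real w = 1" using q_pos by (simp add: w_def)
  moreover have "1 * 1 \<le> 3 * real A * max 1 (log 2 (real n) / real v)"
    using A_pos by (intro mult_mono) auto
  ultimately show ?thesis by linarith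
next
  case False
  then have "real q / real w \<le> 3 * real A * (max 1 (log 2 (real n)) / real v)"
    using q_le_log by (simp add: w_def divide_right_mono)
  moreover have "max 1 (log 2 (real n)) / real v \<le> max 1 (log 2 (real n) / real v)"
    using v_pos by (simp add: max_def field_simps)
  then have "3 * real A * (max 1 (log 2 (real n)) / real v) \<le>
      3 * real A * max 1 (log 2 (real n) / real v)"
    by (rule mult_left_mono) simp
  ultimately show ?thesis by linarith
qed

lemma t_le: "real t \<le> 1 + log 2 (3 * real A) + max 0 (log 2 (log 2 (real n) / real v))"
proof -
  let ?r = "max 1 (log 2 (real n) / real v)"
  have pos: "0 < 3 * real A" "0 < ?r" using A_pos by auto
  have "real (w * 2 ^ t) \<le> real (2 * q)" using scaled_le by (simp only: of_nat_le_iff)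
  then have "2 ^ t \<le> 2 * (real q / real w)" using w_pos by (simp add: field_simps)
  then have "2 ^ t \<le> 2 * (3 * real A * ?r)" using q_div_w_le by linarith
  then have "log 2 (2 ^ t) \<le> log 2 (2 * (3 * real A * ?r))"
    using pos by (subst log_le_cancel_iff) auto
  also have "\<dots> = 1 + log 2 (3 * real A) + log 2 ?r"
    using pos by (simp only: log_mult mult_pos_pos) simp
  finally show ?thesis using n_pos by (simp add: log_nat_power log2_max_one)
qed

lemma size_le:
  assumes "i \<le> n" "\<kappa> \<le> q"
  shows "real (depth 0 * \<kappa> + 3 * (2 ^ l + i * (depth i - l)) + 3 + i * v) + 6 * real n +
      real q * (\<Sum>j<i. real n / 2 ^ depth (Suc j)) \<le>
    real n * real v + size_constant A * real n +
      3 * max (real n * log 2 (log 2 (real n) / real v)) 0"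
proof -
  let ?r = "log 2 (log 2 (real n) / real v)"
  have "depth 0 * \<kappa> \<le> 32 * A\<^sup>2 * n"
    using mult_le_mono2[OF assms(2), of "depth 0"] seed_bits_le by linarith
  with trie_bits_le[OF assms(1)]
  have "depth 0 * \<kappa> + 3 * (2 ^ l + i * (depth i - l)) + 3 + i * v \<le>
      32 * A\<^sup>2 * n + n * v + 3 * (n * t) + 9 * n"
    by linarith
  then have "real (depth 0 * \<kappa> + 3 * (2 ^ l + i * (depth i - l)) + 3 + i * v) \<le>
      real (32 * A\<^sup>2 * n + n * v + 3 * (n * t) + 9 * n)"
    by (simp only: of_nat_le_iff)
  moreover have "real n * real t \<le> real n * (1 + log 2 (3 * real A) + max 0 ?r)"
    by (intro mult_left_mono t_le) simp
  moreover have "real n * max 0 ?r = max (real n * ?r) 0"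
    by (simp add: max_mult_distrib_left max.commute)
  ultimately show ?thesis
    using exception_bits_le[OF assms(1)] unfolding size_constant_def by (simp add: algebra_simps)
qed

end

lemma hashed_trie_mat_vec:
  assumes "inj_on f U" "\<And>k. k \<in> U \<Longrightarrow> length (f k) = \<kappa>" "antimono D"
  shows "hashed_trie U (pmf_of_set (bit_matrices (D 0) \<kappa>)) (\<lambda>s k. mat_vec s (f k)) D concat f"
proof
  let ?S = "pmf_of_set (bit_matrices (D 0) \<kappa>)"
  show "universal_hash U (D 0) ?S (\<lambda>s k. mat_vec s (f k))"
    using assms(1,2) by (rule universal_hash_mat_vec)
  show "prefix_code concat (set_pmf ?S)"
    unfolding set_pmf_of_set[OF bit_matrices_nonempty finite_bit_matrices]
    using inj_on_concat_bit_matrices length_concat_bit_matrix by (rule prefix_code_fixed_length)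
  show "prefix_code f U" using assms(1,2) by (rule prefix_code_fixed_length)
qed (rule assms(3))

lemma ex_small_incremental_retrieval:
  fixes U :: "'k set"
  assumes "1 \<le> n" "1 \<le> v" and U_small: "finite U" "card U \<le> a * n ^ c"
  shows "\<exists>D. incremental_retrieval n v U D \<and> expected_size_at_most n v U D
    (real n * real v + size_constant (a + c + 1) * real n +
      3 * max (real n * log 2 (log 2 (real n) / real v)) 0)"
    (is "\<exists>D. _ \<and> expected_size_at_most n v U D ?B")
proof -
  obtain l where l_bounds: "n \<le> 2 ^ l" "2 ^ l \<le> 2 * n"
    using ex_scaled_power_two[of 1 n] assms(1) by auto
  define \<kappa> where "\<kappa> = a + c * l"
  define w where "w = min v (\<kappa> + 1)"
  have "1 \<le> w" "w \<le> \<kappa> + 1" using assms(2) by (auto simp: w_def)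
  then obtain t where t_bounds: "\<kappa> + 1 \<le> w * 2 ^ t" "w * 2 ^ t \<le> 2 * (\<kappa> + 1)"
    using ex_scaled_power_two by blast
  interpret trie_parameters n v "\<kappa> + 1" l t w "a + c + 1"
    using assms(1,2) l_bounds t_bounds by unfold_locales (simp_all add: \<kappa>_def w_def algebra_simps)
  have "a * n ^ c \<le> 2 ^ a * (2 ^ l) ^ c" using l_bounds(1) by (intro mult_le_mono power_mono) auto
  also have "\<dots> = 2 ^ \<kappa>" by (simp add: \<kappa>_def power_add power_mult[symmetric] mult.commute)
  finally obtain f :: "'k \<Rightarrow> bits" where key_code: "inj_on f U" "\<And>k. k \<in> U \<Longrightarrow> length (f k) = \<kappa>"
    using ex_fixed_length_code[of U \<kappa>] U_small by fastforce
  let ?S = "pmf_of_set (bit_matrices (depth 0) \<kappa>)"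
  have "antimono depth" unfolding depth_def by (rule antimono_cutoff_depth)
  then interpret hashed_trie n v U ?S "\<lambda>s k. mat_vec s (f k)" depth concat f
    using key_code by (intro hashed_trie_mat_vec)
  have seed_len: "length (concat s) = depth 0 * \<kappa>" if "s \<in> set_pmf ?S" for s
    using that unfolding set_pmf_of_set[OF bit_matrices_nonempty finite_bit_matrices]
    by (rule length_concat_bit_matrix)
  have "expected_size ds as \<le> ennreal ?B" if legal: "legal n v U as" for as
  proof -
    have "card (dom (contents as)) \<le> n" using legal_contents[OF legal] by blast
    note size_le[OF this, of \<kappa>]
    then show ?thesis
      using expected_size_le[OF legal seed_len key_code(2) n_le_power_depth, of l]
      by (auto intro: order_trans ennreal_leI)
  qed
  with incremental_retrieval_ds show ?thesis unfolding expected_size_at_most_def by blast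
qed

theorem theorem1:
  fixes a c :: nat
  shows "\<exists>C\<^sub>1 C\<^sub>2 :: real. C\<^sub>1 \<ge> 0 \<and> C\<^sub>2 \<ge> 0 \<and>
    (\<forall>(n::nat) (v::nat) (U::'k set).
       n \<ge> 1 \<and> v \<ge> 1 \<and> finite U \<and> card U \<le> a * n ^ c \<longrightarrow>
       (\<exists>D. incremental_retrieval n v U D \<and>
            expected_size_at_most n v U D
              (real n * real v + C\<^sub>1 * real n
                + C\<^sub>2 * max (real n * log 2 (log 2 (real n) / real v)) 0)))"
proof (rule exI[of _ "size_constant (a + c + 1)"], rule exI[of _ 3], intro conjI allI impI)
  show "0 \<le> size_constant (a + c + 1)" by (simp add: size_constant_def)
  fix n v :: nat and U :: "'k set"
  assume "n \<ge> 1 \<and> v \<ge> 1 \<and> finite U \<and> card U \<le> a * n ^ c"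
  then show "\<exists>D. incremental_retrieval n v U D \<and> expected_size_at_most n v U D
      (real n * real v + size_constant (a + c + 1) * real n
        + 3 * max (real n * log 2 (log 2 (real n) / real v)) 0)"
    by (intro ex_small_incremental_retrieval) auto
qed simp

end
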